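(* $\mathrm{SC} \not\leq_{\mathrm{w}} \mathrm{LUA}_{\mathrm{slow}}$.
   Context: Prefix-free complexity: a prefix-free machine is a partial recursive $M$ from $\{0,1\}^*$ to $\{0,1\}^*$ with prefix-free domain; $U$ is universal if for each prefix-free machine $M$ there is $\rho$ with $U(\rho^\frown\tau)\simeq M(\tau)$ for all $\tau$. Fix a universal $U$ and let $K(\sigma)=\min\{|\tau| : U(\tau)=\sigma\}$. $\mathrm{SC}$ is the set of shift complex sequences: those $X\in\{0,1\}^{\mathbb{N}}$ for which there are $\delta\in(0,1)$ and $c\in\mathbb{N}$ with $K(\tau)\geq\delta|\tau|-c$ for every (contiguous, finite) substring $\tau$ of $X$. An order function is a computable (i.e. its values are uniformly computable reals), nondecreasing, unbounded function $\mathbb{N}\to\mathbb{R}$. An order function $q\colon\mathbb{N}\to(1,\infty)$ is slow-growing if $\sum_{n=0}^\infty q(n)^{-1}=\infty$. A partial recursive $\psi\colon\subseteq\mathbb{N}\to\mathbb{N}$ is linearly universal if for every partial recursive $\theta\colon\subseteq\mathbb{N}\to\mathbb{N}$ there are $a,b\in\mathbb{N}$ with $\psi(ax+b)\simeq\theta(x)$ for all $x$. For $p\colon\mathbb{N}\to(1,\infty)$, $\mathrm{LUA}(p)$ is the set of $X\in\mathbb{N}^{\mathbb{N}}$ such that $X(n)<p(n)$ for all $n$ and, for some linearly universal partial recursive $\psi$, there is no $n\in\operatorname{dom}\psi$ with $X(n)=\psi(n)$. $\mathrm{LUA}_{\mathrm{slow}}=\bigcup\{\mathrm{LUA}(q)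 : q\colon\mathbb{N}\to(1,\infty)\text{ a slow-growing order function}\}$. For $P,Q\subseteq\mathbb{N}^{\mathbb{N}}$, $P\leq_{\mathrm{w}}Q$ means every $Y\in Q$ Turing-computes some $X\in P$. *)

theory Defs
  imports Complex_Main "HOL-Library.Nat_Bijection" "HOL-Library.Sublist"
begin

section \<open>Partial recursive functions and Turing computability\<close>

text \<open>
  Unbounded search: the least \<open>n\<close> with \<open>f(a, n) = 0\<close>, defined only if \<open>f(a, m)\<close> converges
  for all smaller \<open>m\<close>. Such an \<open>n\<close> is unique if it exists.
\<close>

definition minimize :: "(nat \<rightharpoonup> nat) \<Rightarrow> (nat \<rightharpoonup> nat)" where
  "minimize f a =
    (let found = (\<lambda>n. f (prod_encode (a, n)) = Some 0 \<and>
                      (\<forall>m<n. \<exists>v. f (prod_encode (a, m)) = Some (Suc v)))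
     in if \<exists>n. found n then Some (THE n. found n) else None)"

fun prim_rec :: "(nat \<rightharpoonup> nat) \<Rightarrow> (nat \<rightharpoonup> nat) \<Rightarrow> nat \<Rightarrow> nat \<Rightarrow> nat option" where
  "prim_rec f g a 0 = f a"
| "prim_rec f g a (Suc k) =
    Option.bind (prim_rec f g a k) (\<lambda>r. g (prod_encode (a, prod_encode (k, r))))"

text \<open>
  The partial functions that are recursive relative to the total functions in \<open>Or\<close>. All functions
  are unary; several arguments are passed through the Cantor pairing \<^const>\<open>prod_encode\<close>.
\<close>

inductive recursive_in :: "(nat \<Rightarrow> nat) set \<Rightarrow> (nat \<rightharpoonup> nat) \<Rightarrow> bool" for Or where
  zero: "recursive_in Or (\<lambda>_. Some 0)"
| succ: "recursive_in Or (\<lambda>n. Some (Suc n))"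
| first: "recursive_in Or (\<lambda>n. Some (fst (prod_decode n)))"
| second: "recursive_in Or (\<lambda>n. Some (snd (prod_decode n)))"
| oracle_call: "h \<in> Or \<Longrightarrow> recursive_in Or (\<lambda>n. Some (h n))"
| pair: "recursive_in Or f \<Longrightarrow> recursive_in Or g \<Longrightarrow>
    recursive_in Or (\<lambda>n. Option.bind (f n) (\<lambda>x. Option.bind (g n) (\<lambda>y. Some (prod_encode (x, y)))))"
| comp: "recursive_in Or f \<Longrightarrow> recursive_in Or g \<Longrightarrow>
    recursive_in Or (\<lambda>n. Option.bind (g n) f)"
| prec: "recursive_in Or f \<Longrightarrow> recursive_in Or g \<Longrightarrow>
    recursive_in Or (\<lambda>n. prim_rec f g (fst (prod_decode n)) (snd (prod_decode n)))"
| mini: "recursive_in Or f \<Longrightarrow> recursive_in Or (minimize f)"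

definition partial_recursive :: "(nat \<rightharpoonup> nat) \<Rightarrow> bool" where
  "partial_recursive f \<longleftrightarrow> recursive_in {} f"

definition computable :: "(nat \<Rightarrow> nat) \<Rightarrow> bool" where
  "computable f \<longleftrightarrow> partial_recursive (\<lambda>n. Some (f n))"

definition turing_computes :: "(nat \<Rightarrow> nat) \<Rightarrow> (nat \<Rightarrow> nat) \<Rightarrow> bool" where
  "turing_computes Y X \<longleftrightarrow> recursive_in {Y} (\<lambda>n. Some (X n))"

definition weakly_reducible :: "(nat \<Rightarrow> nat) set \<Rightarrow> (nat \<Rightarrow> nat) set \<Rightarrow> bool"
    (infix "\<le>\<^sub>w" 50) where
  "P \<le>\<^sub>w Q \<longleftrightarrow> (\<forall>Y\<in>Q. \<exists>X\<in>P. turing_computes Y X)"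


section \<open>Prefix-free complexity and shift complex sequences\<close>

definition string_code :: "bool list \<Rightarrow> nat" where
  "string_code \<sigma> = list_encode (map of_bool \<sigma>)"

definition partial_recursive_on_strings :: "(bool list \<rightharpoonup> bool list) \<Rightarrow> bool" where
  "partial_recursive_on_strings M \<longleftrightarrow>
    (\<exists>f. partial_recursive f \<and> (\<forall>\<sigma>. f (string_code \<sigma>) = map_option string_code (M \<sigma>)))"

definition prefix_free_machine :: "(bool list \<rightharpoonup> bool list) \<Rightarrow> bool" where
  "prefix_free_machine M \<longleftrightarrow>
    partial_recursive_on_strings M \<and>
    (\<forall>\<sigma>\<in>dom M. \<forall>\<tau>\<in>dom M. prefix \<sigma> \<tau> \<longrightarrow> \<sigma> = \<tau>)"

definition universal_machine :: "(bool list \<rightharpoonup> bool list) \<Rightarrow> bool" where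
  "universal_machine U \<longleftrightarrow>
    prefix_free_machine U \<and>
    (\<forall>M. prefix_free_machine M \<longrightarrow> (\<exists>\<rho>. \<forall>\<tau>. U (\<rho> @ \<tau>) = M \<tau>))"

text \<open>The minimum is over a nonempty set when \<open>U\<close> is universal, as \<open>U\<close> is then surjective.\<close>

definition prefix_complexity :: "(bool list \<rightharpoonup> bool list) \<Rightarrow> bool list \<Rightarrow> nat" where
  "prefix_complexity U \<sigma> = (LEAST n. \<exists>\<tau>. length \<tau> = n \<and> U \<tau> = Some \<sigma>)"

definition substrings :: "(nat \<Rightarrow> bool) \<Rightarrow> bool list set" where
  "substrings X = {map X [i..<j] | i j. i \<le> j}"

definition shift_complex :: "(bool list \<rightharpoonup> bool list) \<Rightarrow> (nat \<Rightarrow> bool) \<Rightarrow> bool" where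
  "shift_complex U X \<longleftrightarrow>
    (\<exists>\<delta>::real. \<exists>c::nat. 0 < \<delta> \<and> \<delta> < 1 \<and>
      (\<forall>\<tau>\<in>substrings X. real (prefix_complexity U \<tau>) \<ge> \<delta> * real (length \<tau>) - real c))"

text \<open>Binary sequences are regarded as elements of Baire space with values 0 and 1.\<close>

definition SC :: "(bool list \<rightharpoonup> bool list) \<Rightarrow> (nat \<Rightarrow> nat) set" where
  "SC U = {(\<lambda>n. of_bool (X n)) | X. shift_complex U X}"


section \<open>Slow-growing order functions and linearly universal avoidance\<close>

text \<open>
  Uniformly computable reals: from \<open>n\<close> and \<open>k\<close> one computes a rational within \<open>2\<^sup>-\<^sup>k\<close> of \<open>q n\<close>,
  given as \<open>(a - b) / (d + 1)\<close> with natural numbers \<open>a\<close>, \<open>b\<close>, \<open>d\<close>.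
\<close>

definition uniformly_computable_reals :: "(nat \<Rightarrow> real) \<Rightarrow> bool" where
  "uniformly_computable_reals q \<longleftrightarrow>
    (\<exists>a b d. computable a \<and> computable b \<and> computable d \<and>
      (\<forall>n k. let m = prod_encode (n, k) in
        \<bar>q n - (real (a m) - real (b m)) / real (Suc (d m))\<bar> \<le> 1 / 2 ^ k))"

definition order_function :: "(nat \<Rightarrow> real) \<Rightarrow> bool" where
  "order_function q \<longleftrightarrow>
    uniformly_computable_reals q \<and> mono q \<and> \<not> bdd_above (range q)"

definition slow_growing :: "(nat \<Rightarrow> real) \<Rightarrow> bool" where
  "slow_growing q \<longleftrightarrow>
    order_function q \<and> (\<forall>n. 1 < q n) \<and>
    filterlim (\<lambda>N. \<Sum>n<N. inverse (q n)) at_top sequentially"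

definition linearly_universal :: "(nat \<rightharpoonup> nat) \<Rightarrow> bool" where
  "linearly_universal \<psi> \<longleftrightarrow>
    partial_recursive \<psi> \<and>
    (\<forall>\<theta>. partial_recursive \<theta> \<longrightarrow> (\<exists>a b. \<forall>x. \<psi> (a * x + b) = \<theta> x))"

definition LUA :: "(nat \<Rightarrow> real) \<Rightarrow> (nat \<Rightarrow> nat) set" where
  "LUA p = {X. (\<forall>n. real (X n) < p n) \<and>
               (\<exists>\<psi>. linearly_universal \<psi> \<and> \<not> (\<exists>n\<in>dom \<psi>. \<psi> n = Some (X n)))}"

definition LUA_slow :: "(nat \<Rightarrow> nat) set" where
  "LUA_slow = \<Union> {LUA q | q. slow_growing q}"

end

theory Submission imports Defs begin

text \<open>
  Forcing with bushy trees. Take a computable staircase \<open>q\<close> whose jumps are enormous compared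
  with everything before them, but each of whose values \<open>Q\<close> is kept for \<open>Q\<close> steps, so that
  \<open>\<Sum> 1/q\<close> diverges. At a jump, a string \<open>\<sigma>\<close> of length \<open>n\<close> and a functional \<open>\<Phi>\<close>, one of two things
  happens. Either the set of extensions on which \<open>\<Phi>\<close> gives \<open>L\<close> bits is small, and it can be avoided
  together with the set of strings agreeing somewhere with the linearly universal function. Or it is
  so big that for some \<open>w \<in> {0,1}\<^sup>L\<close> the extensions on which \<open>\<Phi>\<close> gives \<open>w\<close> are still big enough
  not to be covered by the strings avoided so far; as such a \<open>w\<close> is found effectively from \<open>\<sigma>\<close>, which is
  tiny compared with \<open>L\<close>, the output of \<open>\<Phi>\<close> has a highly compressible initial segment.
\<close>

section \<open>Computable functions and decidable predicates\<close>

abbreviation lft :: "nat \<Rightarrow> nat" where "lft p \<equiv> fst (prod_decode p)"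
abbreviation rgt :: "nat \<Rightarrow> nat" where "rgt p \<equiv> snd (prod_decode p)"

definition decidable :: "(nat \<Rightarrow> bool) \<Rightarrow> bool" where
  "decidable P \<longleftrightarrow> computable (\<lambda>x. of_bool (P x))"

named_theorems computable_intros

lemma computable_comp:
  assumes "computable f" "computable g"
  shows "computable (\<lambda>x. f (g x))"
  using recursive_in.comp[of "{}" "\<lambda>n. Some (f n)" "\<lambda>n. Some (g n)"] assms
  by (simp add: computable_def partial_recursive_def)

lemma computable_prod_encode [computable_intros]:
  assumes "computable f" "computable g"
  shows "computable (\<lambda>x. prod_encode (f x, g x))"
  using recursive_in.pair[of "{}" "\<lambda>n. Some (f n)" "\<lambda>n. Some (g n)"] assms
  by (simp add: computable_def partial_recursive_def)

lemma computable_lft [computable_intros]: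
  "computable f \<Longrightarrow> computable (\<lambda>x. lft (f x))"
  by (rule computable_comp) (simp_all add: computable_def partial_recursive_def recursive_in.first)

lemma computable_rgt [computable_intros]:
  "computable f \<Longrightarrow> computable (\<lambda>x. rgt (f x))"
  by (rule computable_comp) (simp_all add: computable_def partial_recursive_def recursive_in.second)

lemma computable_Suc [computable_intros]:
  "computable f \<Longrightarrow> computable (\<lambda>x. Suc (f x))"
  by (rule computable_comp) (simp_all add: computable_def partial_recursive_def recursive_in.succ)

lemma computable_const [computable_intros]: "computable (\<lambda>_. c)"
proof (induction c)
  case 0
  then show ?case by (simp add: computable_def partial_recursive_def recursive_in.zero)
next
  case (Suc c)
  then show ?case by (rule computable_Suc)
qed

lemma computable_id [computable_intros]: "computable (\<lambda>x. x)"
proof -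
  have "computable (\<lambda>x. prod_encode (lft x, rgt x))"
    by (intro computable_prod_encode)
      (simp_all add: computable_def partial_recursive_def recursive_in.first recursive_in.second)
  then show ?thesis by simp
qed

lemma prim_rec_total:
  "prim_rec (\<lambda>n. Some (f n)) (\<lambda>n. Some (g n)) a k =
    Some (rec_nat (f a) (\<lambda>k r. g (prod_encode (a, prod_encode (k, r)))) k)"
  by (induction k) auto

lemma computable_rec [computable_intros]:
  assumes a: "computable a"
    and b: "computable (\<lambda>p. b (lft p) (lft (rgt p)) (rgt (rgt p)))"
    and n: "computable n"
  shows "computable (\<lambda>x. rec_nat (a x) (b x) (n x))"
proof -
  have "computable (\<lambda>p. rec_nat (a (lft p)) (b (lft p)) (rgt p))"
    using recursive_in.prec[of "{}" "\<lambda>n. Some (a n)"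
        "\<lambda>p. Some (b (lft p) (lft (rgt p)) (rgt (rgt p)))"] a b
    unfolding computable_def partial_recursive_def prim_rec_total by simp
  then show ?thesis
    using computable_comp[OF _ computable_prod_encode[OF computable_id n]] by fastforce
qed

lemma computable_pred [computable_intros]:
  assumes "computable f"
  shows "computable (\<lambda>x. f x - 1)"
proof -
  have "rec_nat 0 (\<lambda>k _. k) n = n - 1" for n :: nat by (cases n) auto
  then show ?thesis
    using computable_rec[OF computable_const[of 0], of "\<lambda>_ k _. k" f] assms
    by (simp add: computable_lft computable_rgt computable_id)
qed

lemma computable_diff [computable_intros]:
  assumes "computable f" "computable g"
  shows "computable (\<lambda>x. f x - g x)"
proof -
  have "rec_nat m (\<lambda>_ r. r - 1) n = m - n" for m n :: nat by (induction n) auto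
  moreover have "computable (\<lambda>x. rec_nat (f x) (\<lambda>_ r. r - 1) (g x))"
    by (intro computable_intros assms)
  ultimately show ?thesis by simp
qed

lemma computable_add [computable_intros]:
  assumes "computable f" "computable g"
  shows "computable (\<lambda>x. f x + g x)"
proof -
  have "rec_nat m (\<lambda>_ r. Suc r) n = m + n" for m n :: nat by (induction n) auto
  moreover have "computable (\<lambda>x. rec_nat (f x) (\<lambda>_ r. Suc r) (g x))"
    by (intro computable_intros assms)
  ultimately show ?thesis by simp
qed

lemma computable_mult [computable_intros]:
  assumes "computable f" "computable g"
  shows "computable (\<lambda>x. f x * g x)"
proof -
  have "rec_nat 0 (\<lambda>_ r. r + m) n = m * n" for m n :: nat by (induction n) auto
  moreover have "computable (\<lambda>x. rec_nat 0 (\<lambda>_ r. r + f x) (g x))"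
    by (intro computable_intros assms computable_comp[OF assms(1)])
  ultimately show ?thesis by simp
qed

lemma computable_power [computable_intros]:
  assumes "computable f" "computable g"
  shows "computable (\<lambda>x. f x ^ g x)"
proof -
  have "rec_nat 1 (\<lambda>_ r. m * r) n = m ^ n" for m n :: nat by (induction n) auto
  moreover have "computable (\<lambda>x. rec_nat 1 (\<lambda>_ r. f x * r) (g x))"
    by (intro computable_intros assms computable_comp[OF assms(1)])
  ultimately show ?thesis by simp
qed

lemma computable_of_bool [computable_intros]:
  "decidable P \<Longrightarrow> computable (\<lambda>x. of_bool (P x))"
  by (simp add: decidable_def)

lemma decidable_comp: "decidable P \<Longrightarrow> computable f \<Longrightarrow> decidable (\<lambda>x. P (f x))"
  unfolding decidable_def by (rule computable_comp)

lemma decidable_le [computable_intros]: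
  assumes "computable f" "computable g"
  shows "decidable (\<lambda>x. f x \<le> g x)"
proof -
  have "(of_bool (m \<le> n) :: nat) = 1 - (m - n)" for m n :: nat by auto
  then show ?thesis
    unfolding decidable_def by (simp only:) (intro computable_intros assms)
qed

lemma decidable_less [computable_intros]:
  assumes "computable f" "computable g"
  shows "decidable (\<lambda>x. f x < g x)"
proof -
  have "decidable (\<lambda>x. Suc (f x) \<le> g x)"
    by (intro decidable_le computable_Suc assms)
  then show ?thesis by (simp add: Suc_le_eq)
qed

lemma decidable_not [computable_intros]:
  assumes "decidable P"
  shows "decidable (\<lambda>x. \<not> P x)"
proof -
  have "(of_bool (\<not> b) :: nat) = 1 - of_bool b" for b by auto
  then show ?thesis
    unfolding decidable_def by (simp only:) (intro computable_intros assms)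
qed

lemma decidable_conj [computable_intros]:
  assumes "decidable P" "decidable Q"
  shows "decidable (\<lambda>x. P x \<and> Q x)"
proof -
  have "(of_bool (b \<and> c) :: nat) = of_bool b * of_bool c" for b c by auto
  then show ?thesis
    unfolding decidable_def by (simp only:) (intro computable_intros assms)
qed

lemma decidable_disj [computable_intros]:
  assumes "decidable P" "decidable Q"
  shows "decidable (\<lambda>x. P x \<or> Q x)"
proof -
  have "decidable (\<lambda>x. \<not> (\<not> P x \<and> \<not> Q x))"
    by (intro decidable_conj decidable_not assms)
  then show ?thesis by simp
qed

lemma decidable_eq [computable_intros]:
  assumes "computable f" "computable g"
  shows "decidable (\<lambda>x. f x = g x)"
proof -
  have "decidable (\<lambda>x. f x \<le> g x \<and> g x \<le> f x)"
    by (intro decidable_conj decidable_le assms)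
  then show ?thesis by (simp add: eq_iff)
qed

lemma computable_if [computable_intros]:
  assumes "decidable P" "computable f" "computable g"
  shows "computable (\<lambda>x. if P x then f x else g x)"
proof -
  have "(if b then m else n) = of_bool b * m + of_bool (\<not> b) * n" for b and m n :: nat by auto
  then show ?thesis
    by (simp only:) (intro computable_intros assms)
qed

lemma computable_sum [computable_intros]:
  assumes "computable (\<lambda>p. f (lft p) (rgt p))" "computable n"
  shows "computable (\<lambda>x. \<Sum>i<n x. f x i)"
proof -
  have "rec_nat 0 (\<lambda>i r. f x i + r) m = (\<Sum>i<m. f x i)" for x m by (induction m) auto
  moreover have "computable (\<lambda>x. rec_nat 0 (\<lambda>i r. f x i + r) (n x))"
    using computable_comp[OF assms(1), of "\<lambda>p. prod_encode (lft p, lft (rgt p))"]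
    by (intro computable_intros assms) (simp add: computable_intros)
  ultimately show ?thesis by simp
qed

lemma computable_card [computable_intros]:
  assumes "decidable (\<lambda>p. P (lft p) (rgt p))" "computable n"
  shows "computable (\<lambda>x. card {i. i < n x \<and> P x i})"
proof -
  have "card {i. i < m \<and> P x i} = (\<Sum>i<m. of_bool (P x i))" for x m
    by (simp add: of_bool_def sum.If_cases Int_def)
  then show ?thesis by (simp only:) (intro computable_intros assms)
qed

lemma decidable_ex_less [computable_intros]:
  assumes "decidable (\<lambda>p. P (lft p) (rgt p))" "computable n"
  shows "decidable (\<lambda>x. \<exists>i<n x. P x i)"
proof -
  have "(\<exists>i<m. P x i) \<longleftrightarrow> 0 < card {i. i < m \<and> P x i}" for x m
    by (auto simp: card_gt_0_iff)
  then show ?thesis by (simp only:) (intro computable_intros assms)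
qed

lemma decidable_all_less [computable_intros]:
  assumes "decidable (\<lambda>p. P (lft p) (rgt p))" "computable n"
  shows "decidable (\<lambda>x. \<forall>i<n x. P x i)"
proof -
  have "decidable (\<lambda>x. \<not> (\<exists>i<n x. \<not> P x i))"
    by (intro decidable_not decidable_ex_less assms)
  then show ?thesis by simp
qed

lemma computable_tl [computable_intros]:
  assumes "computable f"
  shows "computable (\<lambda>x. list_encode (tl (list_decode (f x))))"
proof -
  have "list_encode (tl (list_decode n)) = rgt (n - 1)" for n
  proof (cases n)
    case 0
    then show ?thesis by (simp add: prod_decode_def prod_decode_aux.simps)
  next
    case (Suc m)
    then show ?thesis by (simp add: case_prod_beta)
  qed
  then show ?thesis by (simp only:) (intro computable_intros assms)
qed

lemma list_encode_eq_0_iff: "list_encode xs = 0 \<longleftrightarrow> xs = []"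
  by (cases xs) auto

lemma length_le_list_encode: "length xs \<le> list_encode xs"
proof (induction xs)
  case (Cons x xs)
  then show ?case using le_prod_encode_2[of "list_encode xs" x] by simp
qed simp

lemma computable_drop [computable_intros]:
  assumes "computable f" "computable g"
  shows "computable (\<lambda>x. list_encode (drop (g x) (list_decode (f x))))"
proof -
  have "rec_nat m (\<lambda>_ r. list_encode (tl (list_decode r))) n = list_encode (drop n (list_decode m))"
    for m n by (induction n) (auto simp: drop_Suc tl_drop)
  moreover have "computable (\<lambda>x. rec_nat (f x) (\<lambda>_ r. list_encode (tl (list_decode r))) (g x))"
    by (intro computable_intros assms)
  ultimately show ?thesis by simp
qed

lemma computable_length [computable_intros]:
  assumes "computable f"
  shows "computable (\<lambda>x. length (list_decode (f x)))"
proof -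
  have "length (list_decode n) = card {i. i < n \<and> list_encode (drop i (list_decode n)) \<noteq> 0}" for n
  proof -
    have "{i. i < n \<and> list_encode (drop i (list_decode n)) \<noteq> 0} = {..<length (list_decode n)}"
      using length_le_list_encode[of "list_decode n"] by (auto simp: list_encode_eq_0_iff)
    then show ?thesis by simp
  qed
  then show ?thesis
    by (simp only:) (intro computable_intros assms computable_comp[OF assms(1)])
qed

definition nth_default :: "nat list \<Rightarrow> nat \<Rightarrow> nat" where
  "nth_default xs i = (if i < length xs then xs ! i else 0)"

lemma computable_nth_default [computable_intros]:
  assumes "computable f" "computable g"
  shows "computable (\<lambda>x. nth_default (list_decode (f x)) (g x))"
proof -
  have *: "nth_default xs i = lft (list_encode (drop i xs) - 1)" for xs i
  proof (cases "i < length xs")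
    case True
    then show ?thesis by (simp add: nth_default_def Cons_nth_drop_Suc[symmetric])
  next
    case False
    then show ?thesis by (simp add: nth_default_def prod_decode_def prod_decode_aux.simps)
  qed
  show ?thesis unfolding * by (intro computable_intros assms)
qed

lemma decidable_ball_list [computable_intros]:
  assumes "decidable (\<lambda>p. P (lft p) (rgt p))" "computable f"
  shows "decidable (\<lambda>x. \<forall>e\<in>set (list_decode (f x)). P x e)"
proof -
  have "(\<forall>e\<in>set xs. Q e) \<longleftrightarrow> (\<forall>i<length xs. Q (nth_default xs i))" for xs Q
    by (simp add: nth_default_def all_set_conv_all_nth)
  moreover have "computable (\<lambda>p. prod_encode (lft p, nth_default (list_decode (f (lft p))) (rgt p)))"
    by (intro computable_intros computable_comp[OF assms(2)])
  from decidable_comp[OF assms(1) this]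
  have "decidable (\<lambda>x. \<forall>i<length (list_decode (f x)). P x (nth_default (list_decode (f x)) i))"
    by (intro decidable_all_less computable_length assms(2)) simp
  ultimately show ?thesis by simp
qed

lemma decidable_bex_list [computable_intros]:
  assumes "decidable (\<lambda>p. P (lft p) (rgt p))" "computable f"
  shows "decidable (\<lambda>x. \<exists>e\<in>set (list_decode (f x)). P x e)"
proof -
  have "decidable (\<lambda>x. \<not> (\<forall>e\<in>set (list_decode (f x)). \<not> P x e))"
    by (intro decidable_not decidable_ball_list assms)
  then show ?thesis by simp
qed

lemma decidable_mem_list [computable_intros]:
  assumes "computable g" "computable f"
  shows "decidable (\<lambda>x. g x \<in> set (list_decode (f x)))"
proof -
  have "decidable (\<lambda>x. \<exists>e\<in>set (list_decode (f x)). e = g x)"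
    by (intro computable_intros assms computable_comp[OF assms(1)])
  then show ?thesis by simp
qed

lemma partial_recursive_search:
  assumes "decidable (\<lambda>p. R (lft p) (rgt p))" "computable f"
  shows "partial_recursive (\<lambda>x. if \<exists>t. R x t then Some (f (LEAST t. R x t)) else None)"
proof -
  let ?g = "\<lambda>p. Some (of_bool (\<not> R (lft p) (rgt p)) :: nat)"
  have found: "(?g (prod_encode (a, n)) = Some 0 \<and> (\<forall>m<n. \<exists>v. ?g (prod_encode (a, m)) = Some (Suc v)))
     \<longleftrightarrow> R a n \<and> (\<forall>m<n. \<not> R a m)" for a n
    by (auto simp: of_bool_def)
  have "minimize ?g a = (if \<exists>t. R a t then Some (LEAST t. R a t) else None)" for a
  proof (cases "\<exists>t. R a t")
    case True
    define l where "l = (LEAST t. R a t)"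
    have l: "R a l \<and> (\<forall>m<l. \<not> R a m)"
      using True LeastI_ex[of "R a"] not_less_Least[of _ "R a"] unfolding l_def by blast
    then have "(THE n. R a n \<and> (\<forall>m<n. \<not> R a m)) = l"
      by (intro the_equality) (metis nat_neq_iff)+
    moreover have "\<exists>n. R a n \<and> (\<forall>m<n. \<not> R a m)" using l by blast
    ultimately show ?thesis
      using True unfolding minimize_def found Let_def l_def by simp
  next
    case False
    then show ?thesis unfolding minimize_def found Let_def by simp
  qed
  moreover have "recursive_in {} (minimize ?g)"
    using decidable_not[OF assms(1)]
    by (intro recursive_in.mini) (simp add: decidable_def computable_def partial_recursive_def)
  ultimately have "recursive_in {} (\<lambda>a. if \<exists>t. R a t then Some (LEAST t. R a t) else None)"
    by presburger
  then have "recursive_in {} (\<lambda>a. Option.bind (if \<exists>t. R a t then Some (LEAST t. R a t) else None)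
      (\<lambda>n. Some (f n)))"
    using assms(2) unfolding computable_def partial_recursive_def by (intro recursive_in.comp)
  then show ?thesis
    unfolding partial_recursive_def by (rule back_subst[of "recursive_in {}"]) auto
qed

section \<open>Derivations of computations\<close>

abbreviation entry :: "nat \<Rightarrow> nat \<Rightarrow> nat \<Rightarrow> nat" where
  "entry c x v \<equiv> prod_encode (c, prod_encode (x, v))"

text \<open>
  An entry \<open>(c, x, v)\<close> asserts that the program with code \<open>c\<close> and oracle \<open>h\<close> maps \<open>x\<close> to \<open>v\<close>;
  the tags 0 to 8 of \<open>c\<close> follow the order of the clauses of \<^const>\<open>recursive_in\<close>.
  All quantifiers range over entries or are bounded, so that the condition is decidable.
\<close>

definition justified :: "(nat \<rightharpoonup> nat) \<Rightarrow> nat set \<Rightarrow> nat \<Rightarrow> nat \<Rightarrow> nat \<Rightarrow> bool" where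
  "justified h S c x v \<longleftrightarrow>
    lft c = 0 \<and> v = 0 \<or>
    lft c = 1 \<and> v = Suc x \<or>
    lft c = 2 \<and> v = lft x \<or>
    lft c = 3 \<and> v = rgt x \<or>
    lft c = 4 \<and> h x = Some v \<or>
    lft c = 5 \<and> entry (lft (rgt c)) x (lft v) \<in> S \<and> entry (rgt (rgt c)) x (rgt v) \<in> S \<or>
    lft c = 6 \<and> (\<exists>e\<in>S. lft e = rgt (rgt c) \<and> lft (rgt e) = x \<and>
      entry (lft (rgt c)) (rgt (rgt e)) v \<in> S) \<or>
    lft c = 7 \<and> rgt x = 0 \<and> entry (lft (rgt c)) (lft x) v \<in> S \<or>
    lft c = 7 \<and> rgt x \<noteq> 0 \<and> (\<exists>e\<in>S. lft e = c \<and> lft (rgt e) = prod_encode (lft x, rgt x - 1) \<and>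
      entry (rgt (rgt c)) (prod_encode (lft x, prod_encode (rgt x - 1, rgt (rgt e)))) v \<in> S) \<or>
    lft c = 8 \<and> entry (rgt c) (prod_encode (x, v)) 0 \<in> S \<and>
      (\<forall>m<v. \<exists>e\<in>S. lft e = rgt c \<and> lft (rgt e) = prod_encode (x, m) \<and> rgt (rgt e) \<noteq> 0)"

primrec derivation :: "(nat \<rightharpoonup> nat) \<Rightarrow> nat list \<Rightarrow> bool" where
  "derivation h [] \<longleftrightarrow> True"
| "derivation h (e # d) \<longleftrightarrow>
    justified h (set d) (lft e) (lft (rgt e)) (rgt (rgt e)) \<and> derivation h d"

definition derivable :: "(nat \<rightharpoonup> nat) \<Rightarrow> nat set" where
  "derivable h = {e. \<exists>d. derivation h d \<and> e \<in> set d}"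

lemma bex_entry:
  "(\<exists>e\<in>S. lft e = a \<and> lft (rgt e) = b \<and> P (rgt (rgt e))) \<longleftrightarrow> (\<exists>v. entry a b v \<in> S \<and> P v)"
proof
  assume "\<exists>e\<in>S. lft e = a \<and> lft (rgt e) = b \<and> P (rgt (rgt e))"
  then obtain e where "e \<in> S" "lft e = a" "lft (rgt e) = b" "P (rgt (rgt e))" by blast
  moreover from this have "entry a b (rgt (rgt e)) = e"
    by (metis prod.collapse prod_decode_inverse)
  ultimately show "\<exists>v. entry a b v \<in> S \<and> P v" by metis
qed force

lemma justified_mono:
  assumes "justified h S c x v" "h \<subseteq>\<^sub>m h'" "S \<subseteq> S'"
  shows "justified h' S' c x v"
proof -
  have "h' x = Some v" if "h x = Some v"
    using assms(2) that by (auto simp: map_le_def dom_def)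
  with assms(1) show ?thesis
    unfolding justified_def using assms(3) by (elim disjE) (simp_all, (meson subsetD)+)
qed

lemma derivation_mono: "derivation h d \<Longrightarrow> h \<subseteq>\<^sub>m h' \<Longrightarrow> derivation h' d"
  by (induction d) (simp_all, metis justified_mono subset_refl)

lemma derivation_append: "derivation h d \<Longrightarrow> derivation h d' \<Longrightarrow> derivation h (d @ d')"
proof (induction d)
  case (Cons e d)
  then show ?case
    using justified_mono[of h "set d" _ _ _ h "set (d @ d')"] by auto
qed simp

lemma derivable_mono: "h \<subseteq>\<^sub>m h' \<Longrightarrow> derivable h \<subseteq> derivable h'"
  unfolding derivable_def using derivation_mono by blast

lemma finite_subset_derivable:
  assumes "finite S" "S \<subseteq> derivable h"
  obtains d where "derivation h d" "S \<subseteq> set d"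
proof -
  from assms have "\<exists>d. derivation h d \<and> S \<subseteq> set d"
  proof (induction S)
    case empty
    show ?case using derivation.simps(1) by blast
  next
    case (insert e S)
    then obtain d where d: "derivation h d" "S \<subseteq> set d" by auto
    obtain d' where d': "derivation h d'" "e \<in> set d'"
      using insert.prems by (auto simp: derivable_def)
    have "derivation h (d @ d') \<and> insert e S \<subseteq> set (d @ d')"
      using d d' derivation_append by auto
    then show ?case by blast
  qed
  with that show ?thesis by blast
qed

lemma justified_finite:
  assumes "justified h S c x v"
  shows "\<exists>S'. finite S' \<and> S' \<subseteq> S \<and> justified h S' c x v"
proof -
  consider (base) "justified h {} c x v"
    | (pair) "lft c = 5" "entry (lft (rgt c)) x (lft v) \<in> S" "entry (rgt (rgt c)) x (rgt v) \<in> S"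
    | (comp) e where "lft c = 6" "e \<in> S" "lft e = rgt (rgt c)" "lft (rgt e) = x"
        "entry (lft (rgt c)) (rgt (rgt e)) v \<in> S"
    | (prec0) "lft c = 7" "rgt x = 0" "entry (lft (rgt c)) (lft x) v \<in> S"
    | (prec) e where "lft c = 7" "rgt x \<noteq> 0" "e \<in> S" "lft e = c"
        "lft (rgt e) = prod_encode (lft x, rgt x - 1)"
        "entry (rgt (rgt c)) (prod_encode (lft x, prod_encode (rgt x - 1, rgt (rgt e)))) v \<in> S"
    | (mini) "lft c = 8" "entry (rgt c) (prod_encode (x, v)) 0 \<in> S"
        "\<forall>m<v. \<exists>e\<in>S. lft e = rgt c \<and> lft (rgt e) = prod_encode (x, m) \<and> rgt (rgt e) \<noteq> 0"
    using assms unfolding justified_def by (elim disjE) auto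
  then show ?thesis
  proof cases
    case base
    then show ?thesis by blast
  next
    case pair
    then show ?thesis
      by (intro exI[of _ "{entry (lft (rgt c)) x (lft v), entry (rgt (rgt c)) x (rgt v)}"])
        (simp add: justified_def)
  next
    case comp
    then show ?thesis
      by (intro exI[of _ "{e, entry (lft (rgt c)) (rgt (rgt e)) v}"]) (auto simp: justified_def)
  next
    case prec0
    then show ?thesis
      by (intro exI[of _ "{entry (lft (rgt c)) (lft x) v}"]) (simp add: justified_def)
  next
    case prec
    then show ?thesis
      by (intro exI[of _ "{e, entry (rgt (rgt c))
          (prod_encode (lft x, prod_encode (rgt x - 1, rgt (rgt e)))) v}"])
        (auto simp: justified_def)
  next
    case mini
    then obtain w where w: "\<forall>m<v. w m \<in> S \<and> lft (w m) = rgt c \<and>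
        lft (rgt (w m)) = prod_encode (x, m) \<and> rgt (rgt (w m)) \<noteq> 0"
      by metis
    with mini show ?thesis
      by (intro exI[of _ "insert (entry (rgt c) (prod_encode (x, v)) 0) (w ` {..<v})"])
        (auto simp: justified_def)
  qed
qed

lemma derivable_iff: "entry c x v \<in> derivable h \<longleftrightarrow> justified h (derivable h) c x v"
proof
  have "justified h (derivable h) (lft e) (lft (rgt e)) (rgt (rgt e))"
    if "derivation h d" "e \<in> set d" for d e
    using that
  proof (induction d)
    case (Cons a d)
    moreover have "set d \<subseteq> derivable h"
      using Cons.prems by (auto simp: derivable_def)
    ultimately show ?case
      using justified_mono[of h "set d" _ _ _ h "derivable h"] by auto
  qed simp
  then show "entry c x v \<in> derivable h \<Longrightarrow> justified h (derivable h) c x v"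
    by (fastforce simp: derivable_def)
next
  assume "justified h (derivable h) c x v"
  from justified_finite[OF this] obtain S
    where S: "finite S" "S \<subseteq> derivable h" "justified h S c x v"
    by blast
  obtain d where "derivation h d" "S \<subseteq> set d"
    by (rule finite_subset_derivable[OF S(1,2)])
  then have "derivation h (entry c x v # d)"
    using justified_mono[OF S(3) map_le_refl, of "set d"] by simp
  then show "entry c x v \<in> derivable h"
    unfolding derivable_def by (intro CollectI exI[of _ "entry c x v # d"]) simp
qed

lemma minimize_eq_Some_iff:
  "minimize f a = Some n \<longleftrightarrow>
    f (prod_encode (a, n)) = Some 0 \<and> (\<forall>m<n. \<exists>v. f (prod_encode (a, m)) = Some (Suc v))"
proof -
  let ?found = "\<lambda>n. f (prod_encode (a, n)) = Some 0 \<and>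
    (\<forall>m<n. \<exists>v. f (prod_encode (a, m)) = Some (Suc v))"
  have uniq: "m = n" if "?found m" "?found n" for m n
    using that by (metis nat.distinct(1) nat_neq_iff option.inject)
  then have "(THE n. ?found n) = n" if "?found n" for n
    using that by (intro the_equality) auto
  then show ?thesis
    unfolding minimize_def Let_def by (auto split: if_splits)
qed

lemma derivable_pair_iff:
  "entry (prod_encode (5, prod_encode (f, g))) x v \<in> derivable h \<longleftrightarrow>
    (\<exists>y z. entry f x y \<in> derivable h \<and> entry g x z \<in> derivable h \<and> prod_encode (y, z) = v)"
proof -
  have "P (lft v) \<and> Q (rgt v) \<longleftrightarrow> (\<exists>y z. P y \<and> Q z \<and> prod_encode (y, z) = v)" for P Q
    by (metis fst_conv snd_conv prod.collapse prod_decode_inverse prod_encode_inverse)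
  then show ?thesis
    by (subst derivable_iff) (simp add: justified_def)
qed

lemma derivable_comp_iff:
  "entry (prod_encode (6, prod_encode (f, g))) x v \<in> derivable h \<longleftrightarrow>
    (\<exists>y. entry g x y \<in> derivable h \<and> entry f y v \<in> derivable h)"
  using bex_entry[of "derivable h" g x "\<lambda>y. entry f y v \<in> derivable h"]
  by (subst derivable_iff) (simp add: justified_def)

lemma derivable_prec_0_iff:
  "entry (prod_encode (7, prod_encode (f, g))) (prod_encode (a, 0)) v \<in> derivable h \<longleftrightarrow>
    entry f a v \<in> derivable h"
  by (subst derivable_iff) (simp add: justified_def)

lemma derivable_prec_Suc_iff:
  "entry (prod_encode (7, prod_encode (f, g))) (prod_encode (a, Suc k)) v \<in> derivable h \<longleftrightarrow>
    (\<exists>r. entry (prod_encode (7, prod_encode (f, g))) (prod_encode (a, k)) r \<in> derivable h \<and>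
      entry g (prod_encode (a, prod_encode (k, r))) v \<in> derivable h)"
  using bex_entry[of "derivable h" "prod_encode (7, prod_encode (f, g))" "prod_encode (a, k)"
      "\<lambda>r. entry g (prod_encode (a, prod_encode (k, r))) v \<in> derivable h"]
  by (subst derivable_iff) (simp add: justified_def)

lemma derivable_mini_iff:
  "entry (prod_encode (8, f)) x v \<in> derivable h \<longleftrightarrow>
    entry f (prod_encode (x, v)) 0 \<in> derivable h \<and>
    (\<forall>m<v. \<exists>w. entry f (prod_encode (x, m)) (Suc w) \<in> derivable h)"
proof -
  have "(\<exists>w. entry f y w \<in> S \<and> w \<noteq> 0) \<longleftrightarrow> (\<exists>w. entry f y (Suc w) \<in> S)" for y and S :: "nat set"
    by (metis nat.distinct(1) not0_implies_Suc)
  then show ?thesis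
    using bex_entry[where P = "\<lambda>w. w \<noteq> 0"]
    by (subst derivable_iff) (simp add: justified_def)
qed

lemma recursive_in_code:
  assumes "recursive_in Or f" and "\<And>Y. Y \<in> Or \<Longrightarrow> h = (\<lambda>x. Some (Y x))"
  shows "\<exists>c. \<forall>x v. f x = Some v \<longleftrightarrow> entry c x v \<in> derivable h"
  using assms(1)
proof induction
  case zero
  show ?case
    by (intro exI[of _ "prod_encode (0, 0)"], subst derivable_iff) (auto simp: justified_def)
next
  case succ
  show ?case
    by (intro exI[of _ "prod_encode (1, 0)"], subst derivable_iff) (auto simp: justified_def)
next
  case first
  show ?case
    by (intro exI[of _ "prod_encode (2, 0)"], subst derivable_iff) (auto simp: justified_def)
next
  case second
  show ?case
    by (intro exI[of _ "prod_encode (3, 0)"], subst derivable_iff) (auto simp: justified_def)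
next
  case (oracle_call Y)
  then show ?case
    using assms(2)
    by (intro exI[of _ "prod_encode (4, 0)"], subst derivable_iff) (auto simp: justified_def)
next
  case (pair f g)
  then obtain a b where "\<And>x v. f x = Some v \<longleftrightarrow> entry a x v \<in> derivable h"
    "\<And>x v. g x = Some v \<longleftrightarrow> entry b x v \<in> derivable h" by blast
  then show ?case
    by (intro exI[of _ "prod_encode (5, prod_encode (a, b))"])
      (auto simp: derivable_pair_iff bind_eq_Some_conv)
next
  case (comp f g)
  then obtain a b where "\<And>x v. f x = Some v \<longleftrightarrow> entry a x v \<in> derivable h"
    "\<And>x v. g x = Some v \<longleftrightarrow> entry b x v \<in> derivable h" by blast
  then show ?case
    by (intro exI[of _ "prod_encode (6, prod_encode (a, b))"])
      (auto simp: derivable_comp_iff bind_eq_Some_conv)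
next
  case (prec f g)
  then obtain a b where ab: "\<And>x v. f x = Some v \<longleftrightarrow> entry a x v \<in> derivable h"
    "\<And>x v. g x = Some v \<longleftrightarrow> entry b x v \<in> derivable h" by blast
  have "prim_rec f g x k = Some v \<longleftrightarrow>
      entry (prod_encode (7, prod_encode (a, b))) (prod_encode (x, k)) v \<in> derivable h" for x k v
    by (induction k arbitrary: v)
      (auto simp: ab derivable_prec_0_iff derivable_prec_Suc_iff bind_eq_Some_conv)
  then show ?case
    by (intro exI[of _ "prod_encode (7, prod_encode (a, b))"]) simp
next
  case (mini f)
  then obtain a where "\<And>x v. f x = Some v \<longleftrightarrow> entry a x v \<in> derivable h" by blast
  then show ?case
    by (intro exI[of _ "prod_encode (8, a)"]) (simp add: derivable_mini_iff minimize_eq_Some_iff)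
qed

lemma derivation_finite_use:
  "derivation h d \<Longrightarrow> \<exists>m. \<forall>n\<ge>m. derivation (h |` {..<n}) d"
proof (induction d)
  case (Cons e d)
  then obtain m where m: "\<And>n. n \<ge> m \<Longrightarrow> derivation (h |` {..<n}) d" by auto
  have "justified (h |` {..<n}) (set d) (lft e) (lft (rgt e)) (rgt (rgt e))"
    if "n \<ge> Suc (lft (rgt e))" for n
    using Cons.prems that by (simp add: justified_def)
  with m have "\<forall>n\<ge>max m (Suc (lft (rgt e))). derivation (h |` {..<n}) (e # d)"
    by simp
  then show ?case by blast
qed simp

text \<open>Finite strings are lists in reverse order, so that \<^const>\<open>Cons\<close> extends a string.\<close>

definition oracle_of :: "nat list \<Rightarrow> nat \<rightharpoonup> nat" where
  "oracle_of \<tau> x = (if x < length \<tau> then Some (\<tau> ! (length \<tau> - Suc x)) else None)"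

lemma oracle_Nil: "oracle_of [] = Map.empty"
  by (rule ext) (simp add: oracle_of_def)

lemma oracle_append: "oracle_of \<tau> \<subseteq>\<^sub>m oracle_of (\<rho> @ \<tau>)"
  by (auto simp: map_le_def dom_def oracle_of_def nth_append split: if_splits)

lemma derivation_iff:
  "derivation h d \<longleftrightarrow> (\<forall>i<length d. justified h (set (drop (Suc i) d)) (lft (nth_default d i))
    (lft (rgt (nth_default d i))) (rgt (rgt (nth_default d i))))"
proof (induction d)
  case (Cons e d)
  have "nth_default (e # d) 0 = e" "\<And>i. nth_default (e # d) (Suc i) = nth_default d i"
    by (simp_all add: nth_default_def)
  then show ?case using Cons by (auto simp: less_Suc_eq_0_disj)
qed simp

lemma decidable_oracle [computable_intros]:
  assumes "computable t" "computable x" "computable v"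
  shows "decidable (\<lambda>z. oracle_of (list_decode (t z)) (x z) = Some (v z))"
proof -
  have "oracle_of \<tau> x = Some v \<longleftrightarrow> x < length \<tau> \<and> nth_default \<tau> (length \<tau> - Suc x) = v" for \<tau> x v
    by (auto simp: oracle_of_def nth_default_def)
  then show ?thesis by (simp only:) (intro computable_intros assms)
qed

lemma decidable_justified [computable_intros]:
  assumes "computable t" "computable s" "computable c" "computable x" "computable v"
  shows "decidable (\<lambda>z. justified (oracle_of (list_decode (t z))) (set (list_decode (s z))) (c z) (x z) (v z))"
proof -
  have "decidable (\<lambda>z. justified (oracle_of (list_decode (lft z))) (set (list_decode (lft (rgt z))))
      (lft (rgt (rgt z))) (lft (rgt (rgt (rgt z)))) (rgt (rgt (rgt (rgt z)))))"
    unfolding justified_def by (intro computable_intros)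
  moreover have "computable (\<lambda>z. prod_encode (t z, prod_encode (s z, entry (c z) (x z) (v z))))"
    by (intro computable_intros assms)
  ultimately show ?thesis
    using decidable_comp by fastforce
qed

lemma decidable_derivation [computable_intros]:
  assumes "computable t" "computable d"
  shows "decidable (\<lambda>z. derivation (oracle_of (list_decode (t z))) (list_decode (d z)))"
proof -
  have "decidable (\<lambda>z. \<forall>i<length (list_decode (rgt z)).
      justified (oracle_of (list_decode (lft z)))
        (set (list_decode (list_encode (drop (Suc i) (list_decode (rgt z))))))
        (lft (nth_default (list_decode (rgt z)) i)) (lft (rgt (nth_default (list_decode (rgt z)) i)))
        (rgt (rgt (nth_default (list_decode (rgt z)) i))))"
    by (intro computable_intros)
  then have "decidable (\<lambda>z. derivation (oracle_of (list_decode (lft z))) (list_decode (rgt z)))"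
    by (simp add: derivation_iff)
  moreover have "computable (\<lambda>z. prod_encode (t z, d z))"
    by (intro computable_intros assms)
  ultimately show ?thesis
    using decidable_comp by fastforce
qed

section \<open>A linearly universal partial recursive function\<close>

lemma power_2_odd_inject:
  "(2::nat) ^ a * (2 * x + 1) = 2 ^ b * (2 * y + 1) \<Longrightarrow> a = b \<and> x = y"
proof (induction a arbitrary: b)
  case 0
  then show ?case by (cases b) (auto dest: arg_cong[of _ _ even])
next
  case (Suc a)
  show ?case
  proof (cases b)
    case 0
    then show ?thesis using Suc.prems by (auto dest: arg_cong[of _ _ even])
  next
    case (Suc b')
    then have "(2::nat) ^ a * (2 * x + 1) = 2 ^ b' * (2 * y + 1)"
      using Suc.prems by simp
    then show ?thesis using Suc.IH Suc by blast
  qed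
qed

lemma linearly_universal_exists: "\<exists>\<psi>. linearly_universal \<psi>"
proof -
  define R where "R = (\<lambda>z t. z = 2 ^ lft (lft t) * (2 * lft (rgt (lft t)) + 1) \<and>
    derivation (oracle_of (list_decode 0)) (list_decode (rgt t)) \<and> lft t \<in> set (list_decode (rgt t)))"
  define \<psi> where "\<psi> = (\<lambda>z. if \<exists>t. R z t then Some (rgt (rgt (lft (LEAST t. R z t)))) else None)"
  have "decidable (\<lambda>p. R (lft p) (rgt p))"
    unfolding R_def by (intro computable_intros)
  moreover have "computable (\<lambda>t. rgt (rgt (lft t)))"
    by (intro computable_intros)
  ultimately have "partial_recursive \<psi>"
    unfolding \<psi>_def using partial_recursive_search[of R "\<lambda>t. rgt (rgt (lft t))"] by simp
  moreover have "\<exists>a b. \<forall>x. \<psi> (a * x + b) = \<theta> x" if "partial_recursive \<theta>" for \<theta>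
  proof -
    obtain c where c: "\<And>x v. \<theta> x = Some v \<longleftrightarrow> entry c x v \<in> derivable Map.empty"
      using recursive_in_code[of "{}" \<theta> Map.empty] \<open>partial_recursive \<theta>\<close>
      unfolding partial_recursive_def by blast
    have sound: "\<theta> x = Some (rgt (rgt (lft t)))" if "R (2 ^ c * (2 * x + 1)) t" for x t
    proof -
      have "lft (lft t) = c" "lft (rgt (lft t)) = x"
        using that power_2_odd_inject unfolding R_def by metis+
      then have "lft t = entry c x (rgt (rgt (lft t)))"
        by (metis prod.collapse prod_decode_inverse)
      moreover have "lft t \<in> derivable Map.empty"
        using that by (auto simp: R_def derivable_def oracle_Nil)
      ultimately show ?thesis using c by metis
    qed
    have complete: "\<exists>t. R (2 ^ c * (2 * x + 1)) t" if "\<theta> x = Some v" for x v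
    proof -
      have "entry c x v \<in> derivable Map.empty"
        using that c by simp
      then obtain d where "derivation Map.empty d" "entry c x v \<in> set d"
        unfolding derivable_def by blast
      then have "R (2 ^ c * (2 * x + 1)) (prod_encode (entry c x v, list_encode d))"
        unfolding R_def by (simp add: oracle_Nil)
      then show ?thesis by blast
    qed
    have "\<psi> (2 ^ c * (2 * x + 1)) = \<theta> x" for x
    proof (cases "\<exists>t. R (2 ^ c * (2 * x + 1)) t")
      case True
      then show ?thesis
        unfolding \<psi>_def using sound LeastI_ex[OF True] by simp
    next
      case False
      then show ?thesis
        unfolding \<psi>_def using complete by (cases "\<theta> x") (simp, blast)
    qed
    then show ?thesis
      by (intro exI[of _ "2 ^ Suc c"] exI[of _ "2 ^ c"]) (simp add: algebra_simps)
  qed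
  ultimately show ?thesis unfolding linearly_universal_def by blast
qed

section \<open>A slow-growing order function with large jumps\<close>

primrec max_code :: "nat \<Rightarrow> nat \<Rightarrow> nat" where
  "max_code Q 0 = 0"
| "max_code Q (Suc n) = Suc (prod_encode (Q, max_code Q n))"

definition output_length :: "nat \<Rightarrow> nat \<Rightarrow> nat" where
  "output_length n z = Suc n * (z + 2)"

definition jump :: "nat \<Rightarrow> nat \<Rightarrow> nat" where
  "jump n Q = 2 * n * 2 ^ output_length n (max_code Q n) + Q"

text \<open>
  \<open>stage n\<close> encodes the value at \<open>n\<close> and the number of further steps for which it is kept.
  Keeping a value \<open>Q\<close> for \<open>Q\<close> steps makes the sum of the reciprocals diverge, while the
  jumps in between may be arbitrarily large.
\<close>

primrec stage :: "nat \<Rightarrow> nat" where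
  "stage 0 = prod_encode (2, 0)"
| "stage (Suc n) =
    (if rgt (stage n) = 0 then prod_encode (jump (Suc n) (lft (stage n)), jump (Suc n) (lft (stage n)))
     else prod_encode (lft (stage n), rgt (stage n) - 1))"

definition staircase :: "nat \<Rightarrow> nat" where
  "staircase n = lft (stage n)"

lemma prod_encode_mono: "a \<le> a' \<Longrightarrow> b \<le> b' \<Longrightarrow> prod_encode (a, b) \<le> prod_encode (a', b')"
  unfolding prod_encode_def triangle_def
  by (simp only: prod.case) (intro add_mono div_le_mono mult_le_mono, auto)

lemma list_encode_le_max_code:
  "\<forall>x\<in>set xs. x \<le> Q \<Longrightarrow> list_encode xs \<le> max_code Q (length xs)"
  by (induction xs) (auto intro: prod_encode_mono)

lemma computable_output_length [computable_intros]:
  "computable f \<Longrightarrow> computable g \<Longrightarrow> computable (\<lambda>x. output_length (f x) (g x))"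
  unfolding output_length_def by (intro computable_intros)

lemma computable_staircase [computable_intros]:
  assumes "computable f"
  shows "computable (\<lambda>x. staircase (f x))"
proof -
  have max_code: "max_code Q n = rec_nat 0 (\<lambda>_ r. Suc (prod_encode (Q, r))) n" for Q n
    by (induction n) auto
  have "stage n = rec_nat (prod_encode (2, 0)) (\<lambda>n s.
      if rgt s = 0 then prod_encode (jump (Suc n) (lft s), jump (Suc n) (lft s))
      else prod_encode (lft s, rgt s - 1)) n" for n
    by (induction n) auto
  moreover have "computable (\<lambda>x. rec_nat (prod_encode (2, 0)) (\<lambda>n s.
      if rgt s = 0 then prod_encode (jump (Suc n) (lft s), jump (Suc n) (lft s))
      else prod_encode (lft s, rgt s - 1)) (f x))"
    unfolding jump_def max_code by (intro computable_intros assms)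
  ultimately show ?thesis
    unfolding staircase_def by (simp only:) (rule computable_lft)
qed

lemma staircase_mono: "mono staircase"
  unfolding incseq_Suc_iff staircase_def by (auto simp: jump_def)

lemma staircase_0: "staircase 0 = 2"
  by (simp add: staircase_def)

lemma staircase_ge_2: "staircase n \<ge> 2"
  using monoD[OF staircase_mono, of 0 n] staircase_0 by simp

lemma stage_plateau: "i \<le> rgt (stage n) \<Longrightarrow> stage (n + i) = prod_encode (staircase n, rgt (stage n) - i)"
  by (induction i) (auto simp: staircase_def)

lemma stage_jump:
  "\<exists>n\<ge>N. stage (Suc n) = prod_encode (jump (Suc n) (staircase n), jump (Suc n) (staircase n))"
proof -
  have "rgt (stage (N + rgt (stage N))) = 0"
    by (simp add: stage_plateau)
  then have "stage (Suc (N + rgt (stage N))) =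
      prod_encode (jump (Suc (N + rgt (stage N))) (staircase (N + rgt (stage N))),
        jump (Suc (N + rgt (stage N))) (staircase (N + rgt (stage N))))"
    by (simp add: staircase_def)
  then show ?thesis by (metis le_add1)
qed

lemma staircase_jump: "\<exists>n\<ge>N. staircase (Suc n) = jump (Suc n) (staircase n)"
  using stage_jump[of N] by (metis staircase_def fst_conv prod_encode_inverse)

lemma staircase_unbounded: "\<exists>m. n < staircase m"
proof -
  obtain m where "m \<ge> n" "staircase (Suc m) = jump (Suc m) (staircase m)"
    using staircase_jump by blast
  moreover have "Suc m * 1 \<le> (2 * Suc m) * 2 ^ output_length (Suc m) (max_code (staircase m) (Suc m))"
    by (intro mult_le_mono) auto
  then have "jump (Suc m) (staircase m) \<ge> Suc m"
    unfolding jump_def mult_1_right by (rule trans_le_add1)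
  ultimately have "n < staircase (Suc m)" by simp
  then show ?thesis ..
qed

lemma staircase_plateau_sum:
  assumes "stage m = prod_encode (Q, Q)"
  shows "(\<Sum>n\<in>{m..<m + Q}. inverse (real (staircase n))) = 1"
proof -
  have Q: "Q = staircase m"
    by (simp add: staircase_def assms)
  have "staircase n = Q" if "n \<in> {m..<m + Q}" for n
  proof -
    have "stage (m + (n - m)) = prod_encode (staircase m, rgt (stage m) - (n - m))"
      using that assms by (intro stage_plateau) auto
    with that Q show ?thesis by (simp add: staircase_def)
  qed
  then have "(\<Sum>n\<in>{m..<m + Q}. inverse (real (staircase n))) = real Q * inverse (real Q)"
    by simp
  then show ?thesis
    using staircase_ge_2[of m] Q by simp
qed

lemma slow_growing_staircase: "slow_growing (\<lambda>n. real (staircase n))"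
proof -
  have "computable (\<lambda>m. staircase (lft m))" "computable (\<lambda>_. 0)"
    by (intro computable_intros)+
  then have "uniformly_computable_reals (\<lambda>n. real (staircase n))"
    unfolding uniformly_computable_reals_def
    by (intro exI[of _ "\<lambda>m. staircase (lft m)"] exI[of _ "\<lambda>_. 0"]) simp
  moreover have "mono (\<lambda>n. real (staircase n))"
    using staircase_mono by (auto simp: mono_def)
  moreover have "\<not> bdd_above (range (\<lambda>n. real (staircase n)))"
  proof
    assume "bdd_above (range (\<lambda>n. real (staircase n)))"
    then obtain b where b: "\<And>n. real (staircase n) \<le> b"
      by (auto simp: bdd_above_def)
    obtain n where "nat \<lceil>b\<rceil> < staircase n"
      using staircase_unbounded by blast
    with b[of n] show False by linarith
  qed
  moreover have "\<forall>n. 1 < real (staircase n)"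
  proof
    fix n
    show "1 < real (staircase n)" using staircase_ge_2[of n] by linarith
  qed
  moreover have "filterlim (\<lambda>N. \<Sum>n<N. inverse (real (staircase n))) at_top sequentially"
  proof -
    let ?s = "\<lambda>N. \<Sum>n<N. inverse (real (staircase n))"
    have mono: "?s M \<le> ?s N" if "M \<le> N" for M N
      using that by (intro sum_mono2) auto
    have large: "\<exists>N. real j \<le> ?s N" for j
    proof (induction j)
      case 0
      show ?case by (intro exI[of _ 0]) simp
    next
      case (Suc j)
      then obtain N where N: "real j \<le> ?s N" ..
      obtain m Q where m: "m \<ge> N" "stage m = prod_encode (Q, Q)"
        using stage_jump[of N] by (metis le_SucI)
      have "?s (m + Q) = ?s m + (\<Sum>n\<in>{m..<m + Q}. inverse (real (staircase n)))"
        unfolding lessThan_atLeast0 by (simp add: sum.atLeastLessThan_concat)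
      also have "\<dots> \<ge> real (Suc j)"
        using staircase_plateau_sum[OF m(2)] mono[OF m(1)] N by simp
      finally show ?case by blast
    qed
    show ?thesis
      unfolding filterlim_at_top eventually_sequentially
    proof
      fix Z :: real
      obtain N where N: "real (nat \<lceil>Z\<rceil>) \<le> ?s N" using large by blast
      have "Z \<le> ?s M" if "N \<le> M" for M
      proof -
        have "Z \<le> real (nat \<lceil>Z\<rceil>)" by linarith
        with N mono[OF that] show ?thesis by linarith
      qed
      then show "\<exists>N. \<forall>n\<ge>N. Z \<le> ?s n" by blast
    qed
  qed
  ultimately show ?thesis
    unfolding slow_growing_def order_function_def by blast
qed

section \<open>Bushy trees\<close>

inductive big :: "(nat \<Rightarrow> nat) \<Rightarrow> nat \<Rightarrow> nat list set \<Rightarrow> nat list \<Rightarrow> bool" for q k D where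
  leaf: "\<sigma> \<in> D \<Longrightarrow> big q k D \<sigma>"
| node: "S \<subseteq> {..<q (length \<sigma>)} \<Longrightarrow> k \<le> card S \<Longrightarrow> (\<And>a. a \<in> S \<Longrightarrow> big q k D (a # \<sigma>)) \<Longrightarrow> big q k D \<sigma>"

primrec bounded_by :: "(nat \<Rightarrow> nat) \<Rightarrow> nat list \<Rightarrow> bool" where
  "bounded_by q [] \<longleftrightarrow> True"
| "bounded_by q (a # \<sigma>) \<longleftrightarrow> a < q (length \<sigma>) \<and> bounded_by q \<sigma>"

lemma oracle_of_Cons: "oracle_of (a # \<tau>) = (oracle_of \<tau>)(length \<tau> \<mapsto> a)"
  by (rule ext) (auto simp: oracle_of_def nth_Cons')

lemma bounded_by_oracle: "bounded_by q \<tau> \<Longrightarrow> oracle_of \<tau> x = Some v \<Longrightarrow> v < q x"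
  by (induction \<tau>) (auto simp: oracle_Nil oracle_of_Cons split: if_splits)

lemma bounded_by_set: "mono q \<Longrightarrow> bounded_by q \<tau> \<Longrightarrow> length \<tau> \<le> Suc n \<Longrightarrow> \<forall>x\<in>set \<tau>. x \<le> q n"
proof (induction \<tau>)
  case (Cons a \<tau>)
  moreover from this have "q (length \<tau>) \<le> q n" by (simp add: monoD)
  ultimately show ?case by auto
qed simp

lemma big_mono:
  "big q k D \<sigma> \<Longrightarrow> k' \<le> k \<Longrightarrow> D \<subseteq> D' \<Longrightarrow> big q k' D' \<sigma>"
proof (induction rule: big.induct)
  case (leaf \<sigma>)
  then show ?case by (auto intro: big.leaf)
next
  case (node S \<sigma>)
  then show ?case by - (rule big.node[of S], auto)
qed

lemma big_Un: "big q (k + l) (D \<union> E) \<sigma> \<Longrightarrow> big q k D \<sigma> \<or> big q l E \<sigma>"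
proof (induction rule: big.induct)
  case (leaf \<sigma>)
  then show ?case by (auto intro: big.leaf)
next
  case (node S \<sigma>)
  let ?S1 = "{a \<in> S. big q k D (a # \<sigma>)}" and ?S2 = "{a \<in> S. big q l E (a # \<sigma>)}"
  have "S = ?S1 \<union> ?S2" using node.IH by blast
  then have "card S \<le> card ?S1 + card ?S2" using card_Un_le[of ?S1 ?S2] by simp
  then consider "k \<le> card ?S1" | "l \<le> card ?S2" using node.hyps(2) by linarith
  then show ?case
  proof cases
    case 1
    then have "big q k D \<sigma>" using node.hyps(1) by - (rule big.node[of ?S1], auto)
    then show ?thesis ..
  next
    case 2
    then have "big q l E \<sigma>" using node.hyps(1) by - (rule big.node[of ?S2], auto)
    then show ?thesis ..
  qed
qed

lemma big_UN:
  assumes "finite W" "W \<noteq> {}" "big q (k * card W) (\<Union>w\<in>W. D w) \<sigma>"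
  shows "\<exists>w\<in>W. big q k (D w) \<sigma>"
  using assms
proof (induction W rule: finite_ne_induct)
  case (insert w W)
  then have "big q (k + k * card W) (D w \<union> (\<Union>w\<in>W. D w)) \<sigma>" by simp
  then consider "big q k (D w) \<sigma>" | "big q (k * card W) (\<Union>w\<in>W. D w) \<sigma>"
    using big_Un by blast
  then show ?case using insert.IH by cases blast+
qed simp

lemma big_leaf_not_big:
  assumes "big q k D \<sigma>" "\<not> big q k B \<sigma>" "bounded_by q \<sigma>"
  shows "\<exists>\<rho>. \<rho> @ \<sigma> \<in> D \<and> \<not> big q k B (\<rho> @ \<sigma>) \<and> bounded_by q (\<rho> @ \<sigma>)"
  using assms
proof (induction rule: big.induct)
  case (leaf \<sigma>)
  then show ?case by (intro exI[of _ "[]"]) simp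
next
  case (node S \<sigma>)
  obtain a where a: "a \<in> S" "\<not> big q k B (a # \<sigma>)"
    using big.node[of S q \<sigma> k B] node.hyps(1,2) node.prems(1) by blast
  then have "bounded_by q (a # \<sigma>)" using node.hyps(1) node.prems(2) by auto
  from node.IH[OF a this] obtain \<rho> where "\<rho> @ a # \<sigma> \<in> D \<and> \<not> big q k B (\<rho> @ a # \<sigma>) \<and> bounded_by q (\<rho> @ a # \<sigma>)"
    by blast
  then show ?case by (intro exI[of _ "\<rho> @ [a]"]) simp
qed

lemma not_big_extend:
  assumes "mono q" "k \<le> q (length \<sigma>)" "\<not> big q k B \<sigma>" "bounded_by q \<sigma>"
  shows "\<exists>\<rho>. length \<rho> = n \<and> \<not> big q k B (\<rho> @ \<sigma>) \<and> bounded_by q (\<rho> @ \<sigma>)"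
proof (induction n)
  case 0
  then show ?case using assms by simp
next
  case (Suc n)
  then obtain \<rho> where \<rho>: "length \<rho> = n" "\<not> big q k B (\<rho> @ \<sigma>)" "bounded_by q (\<rho> @ \<sigma>)" by blast
  have "k \<le> q (length (\<rho> @ \<sigma>))"
    using monoD[OF assms(1), of "length \<sigma>" "length (\<rho> @ \<sigma>)"] assms(2) by simp
  then obtain a where "a < q (length (\<rho> @ \<sigma>))" "\<not> big q k B (a # \<rho> @ \<sigma>)"
    using big.node[of "{..<q (length (\<rho> @ \<sigma>))}" q "\<rho> @ \<sigma>" k B] \<rho>(2) by auto
  then show ?case using \<rho> by (intro exI[of _ "a # \<rho>"]) simp
qed

lemma not_big_diagonal:
  "\<not> big q 2 {\<tau>. \<exists>x v. oracle_of \<tau> x = Some v \<and> \<psi> x = Some v} []"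
proof -
  let ?B = "{\<tau>. \<exists>x v. oracle_of \<tau> x = Some v \<and> \<psi> x = Some v}"
  have "\<tau> \<in> ?B" if "big q 2 ?B \<tau>" for \<tau>
    using that
  proof (induction rule: big.induct)
    case (node S \<tau>)
    then obtain a b where ab: "a \<in> S" "b \<in> S" "a \<noteq> b"
      by (metis card_le_Suc0_iff_eq finite_lessThan finite_subset not_less_eq_eq numeral_2_eq_2)
    have "\<tau> \<in> ?B \<or> \<psi> (length \<tau>) = Some a" if "a # \<tau> \<in> ?B" for a
      using that by (auto simp: oracle_of_Cons split: if_splits)
    then have "\<tau> \<in> ?B \<or> \<psi> (length \<tau>) = Some a" "\<tau> \<in> ?B \<or> \<psi> (length \<tau>) = Some b"
      using node.IH ab(1,2) by blast+
    then show ?case using ab(3) by (metis option.inject)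
  qed
  moreover have "[] \<notin> ?B" by (simp add: oracle_Nil)
  ultimately show ?thesis by blast
qed

text \<open>
  A finite set of strings in which every string is in \<open>D\<close> or has \<open>k\<close> children witnesses
  bigness; it need not be given with an order, as children are longer.
\<close>

lemma big_iff_tree:
  "big q k D \<sigma> \<longleftrightarrow> (\<exists>T. finite T \<and> \<sigma> \<in> T \<and>
    (\<forall>\<tau>\<in>T. \<tau> \<in> D \<or> k \<le> card {a. a < q (length \<tau>) \<and> a # \<tau> \<in> T}))" (is "_ \<longleftrightarrow> (\<exists>T. ?P T \<sigma>)")
proof
  assume "big q k D \<sigma>"
  then show "\<exists>T. ?P T \<sigma>"
  proof (induction rule: big.induct)
    case (leaf \<sigma>)
    then show ?case by (intro exI[of _ "{\<sigma>}"]) simp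
  next
    case (node S \<sigma>)
    then have "\<forall>a\<in>S. \<exists>T. ?P T (a # \<sigma>)" by blast
    then obtain T where T: "\<And>a. a \<in> S \<Longrightarrow> ?P (T a) (a # \<sigma>)" by metis
    have "finite S" using node.hyps(1) finite_subset by blast
    let ?T = "insert \<sigma> (\<Union>a\<in>S. T a)"
    have "\<tau> \<in> D \<or> k \<le> card {a. a < q (length \<tau>) \<and> a # \<tau> \<in> ?T}" if \<tau>: "\<tau> \<in> ?T" for \<tau>
    proof (cases "\<tau> = \<sigma>")
      case True
      have "S \<subseteq> {a. a < q (length \<sigma>) \<and> a # \<sigma> \<in> ?T}" using node.hyps(1) T by blast
      then have "card S \<le> card {a. a < q (length \<sigma>) \<and> a # \<sigma> \<in> ?T}" by (intro card_mono) auto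
      with node.hyps(2) have "k \<le> card {a. a < q (length \<sigma>) \<and> a # \<sigma> \<in> ?T}" by (rule order_trans)
      then show ?thesis unfolding True by blast
    next
      case False
      then obtain b where b: "b \<in> S" "\<tau> \<in> T b" using \<tau> by blast
      have "card {a. a < q (length \<tau>) \<and> a # \<tau> \<in> T b} \<le> card {a. a < q (length \<tau>) \<and> a # \<tau> \<in> ?T}"
        using b(1) by (intro card_mono) auto
      then show ?thesis using T[OF b(1)] b(2) le_trans by blast
    qed
    moreover have "finite ?T" using \<open>finite S\<close> T by blast
    ultimately show ?case by (intro exI[of _ ?T]) blast
  qed
next
  assume "\<exists>T. ?P T \<sigma>"
  then obtain T where T: "finite T" "\<sigma> \<in> T"
    "\<forall>\<tau>\<in>T. \<tau> \<in> D \<or> k \<le> card {a. a < q (length \<tau>) \<and> a # \<tau> \<in> T}" by blast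
  obtain M where M: "\<And>\<tau>. \<tau> \<in> T \<Longrightarrow> length \<tau> \<le> M"
    using T(1) by (metis finite_imageI finite_nat_set_iff_bounded_le imageI)
  have "big q k D \<tau>" if "\<tau> \<in> T" for \<tau>
    using that
  proof (induction "M - length \<tau>" arbitrary: \<tau> rule: less_induct)
    case less
    consider "\<tau> \<in> D" | "k \<le> card {a. a < q (length \<tau>) \<and> a # \<tau> \<in> T}" using T(3) less.prems by blast
    then show ?case
    proof cases
      case 1
      then show ?thesis by (rule big.leaf)
    next
      case 2
      have "big q k D (a # \<tau>)" if "a # \<tau> \<in> T" for a
        using that M[OF that] by (intro less.hyps) auto
      with 2 show ?thesis by - (rule big.node[of "{a. a < q (length \<tau>) \<and> a # \<tau> \<in> T}"], auto)
    qed
  qed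
  then show "big q k D \<sigma>" using T(2) by blast
qed

section \<open>Compressing strings computed along bushy trees\<close>

definition forces :: "nat \<Rightarrow> nat list \<Rightarrow> nat list set" where
  "forces c w = {\<tau>. \<forall>i<length w. entry c i (w ! i) \<in> derivable (oracle_of \<tau>)}"

lemma forces_iff:
  "\<tau> \<in> forces c w \<longleftrightarrow> (\<exists>e. derivation (oracle_of \<tau>) (list_decode e) \<and>
    (\<forall>i<length w. entry c i (nth_default w i) \<in> set (list_decode e)))"
proof
  assume "\<tau> \<in> forces c w"
  then have "(\<lambda>i. entry c i (nth_default w i)) ` {..<length w} \<subseteq> derivable (oracle_of \<tau>)"
    by (auto simp: forces_def nth_default_def)
  then obtain d where "derivation (oracle_of \<tau>) d"
    "(\<lambda>i. entry c i (nth_default w i)) ` {..<length w} \<subseteq> set d"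
    by (rule finite_subset_derivable[rotated]) simp_all
  then show "\<exists>e. derivation (oracle_of \<tau>) (list_decode e) \<and>
    (\<forall>i<length w. entry c i (nth_default w i) \<in> set (list_decode e))"
    by (intro exI[of _ "list_encode d"]) auto
qed (auto simp: forces_def derivable_def nth_default_def)

definition tree_code :: "nat \<Rightarrow> nat \<Rightarrow> nat \<Rightarrow> nat \<Rightarrow> nat \<Rightarrow> bool" where
  "tree_code c z w s d \<longleftrightarrow>
    z \<in> set (list_decode d) \<and>
    (\<forall>t\<in>set (list_decode d).
      (\<exists>e<s. derivation (oracle_of (list_decode t)) (list_decode e) \<and>
        (\<forall>i<length (list_decode w). entry c i (nth_default (list_decode w) i) \<in> set (list_decode e))) \<or>
      length (list_decode z) \<le>
        card {a. a < staircase (length (list_decode t)) \<and> Suc (prod_encode (a, t)) \<in> set (list_decode d)})"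

lemma big_iff_tree_code:
  "big staircase (length \<sigma>) (forces c w) \<sigma> \<longleftrightarrow> (\<exists>s d. tree_code c (list_encode \<sigma>) (list_encode w) s d)"
proof
  assume "big staircase (length \<sigma>) (forces c w) \<sigma>"
  then obtain T where T: "finite T" "\<sigma> \<in> T"
    "\<And>\<tau>. \<tau> \<in> T \<Longrightarrow> \<tau> \<in> forces c w \<or> length \<sigma> \<le> card {a. a < staircase (length \<tau>) \<and> a # \<tau> \<in> T}"
    unfolding big_iff_tree by blast
  let ?P = "\<lambda>\<tau> e. derivation (oracle_of \<tau>) (list_decode e) \<and>
    (\<forall>i<length w. entry c i (nth_default w i) \<in> set (list_decode e))"
  have "\<forall>\<tau>. \<exists>e. \<tau> \<in> forces c w \<longrightarrow> ?P \<tau> e"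
    using forces_iff by blast
  then obtain g where g: "\<And>\<tau>. \<tau> \<in> forces c w \<Longrightarrow> ?P \<tau> (g \<tau>)"
    by metis
  obtain s where s: "\<And>\<tau>. \<tau> \<in> T \<Longrightarrow> g \<tau> < s"
    using finite_nat_set_iff_bounded[of "g ` T"] T(1) by auto
  obtain d where d: "set d = list_encode ` T"
    using finite_list[of "list_encode ` T"] T(1) by blast
  have mem: "Suc (prod_encode (a, list_encode \<tau>)) \<in> set d \<longleftrightarrow> a # \<tau> \<in> T" for a \<tau>
    using inj_image_mem_iff[OF inj_list_encode, of "a # \<tau>" T] by (simp add: d)
  have "tree_code c (list_encode \<sigma>) (list_encode w) s (list_encode d)"
    unfolding tree_code_def
  proof (intro conjI ballI)
    fix t assume "t \<in> set (list_decode (list_encode d))"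
    then obtain \<tau> where \<tau>: "\<tau> \<in> T" "t = list_encode \<tau>" by (auto simp: d)
    show "(\<exists>e<s. derivation (oracle_of (list_decode t)) (list_decode e) \<and>
        (\<forall>i<length (list_decode (list_encode w)).
          entry c i (nth_default (list_decode (list_encode w)) i) \<in> set (list_decode e))) \<or>
      length (list_decode (list_encode \<sigma>)) \<le> card {a. a < staircase (length (list_decode t)) \<and>
        Suc (prod_encode (a, t)) \<in> set (list_decode (list_encode d))}"
      using T(3)[OF \<tau>(1)] g[of \<tau>] s[OF \<tau>(1)] unfolding \<tau>(2) list_encode_inverse mem by blast
  qed (use T(2) d in auto)
  then show "\<exists>s d. tree_code c (list_encode \<sigma>) (list_encode w) s d" by blast
next
  assume "\<exists>s d. tree_code c (list_encode \<sigma>) (list_encode w) s d"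
  then obtain s d where sd: "tree_code c (list_encode \<sigma>) (list_encode w) s d" by blast
  let ?T = "list_decode ` set (list_decode d)"
  have mem: "Suc (prod_encode (a, t)) \<in> set (list_decode d) \<Longrightarrow> a # list_decode t \<in> ?T" for a t
    by (intro image_eqI[of _ _ "Suc (prod_encode (a, t))"]) simp_all
  have "list_decode t \<in> forces c w \<or>
      length \<sigma> \<le> card {a. a < staircase (length (list_decode t)) \<and> a # list_decode t \<in> ?T}"
    if t: "t \<in> set (list_decode d)" for t
  proof -
    consider "list_decode t \<in> forces c w" | "length \<sigma> \<le>
        card {a. a < staircase (length (list_decode t)) \<and> Suc (prod_encode (a, t)) \<in> set (list_decode d)}"
      using sd t unfolding tree_code_def forces_iff list_encode_inverse by blast
    then show ?thesis
    proof cases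
      case 2
      moreover have "card {a. a < staircase (length (list_decode t)) \<and> Suc (prod_encode (a, t)) \<in> set (list_decode d)}
          \<le> card {a. a < staircase (length (list_decode t)) \<and> a # list_decode t \<in> ?T}"
        using mem by (intro card_mono) auto
      ultimately show ?thesis by (meson le_trans)
    qed simp
  qed
  moreover have "\<sigma> \<in> ?T"
    using sd unfolding tree_code_def by (metis image_eqI list_encode_inverse)
  ultimately show "big staircase (length \<sigma>) (forces c w) \<sigma>"
    unfolding big_iff_tree by (intro exI[of _ ?T]) auto
qed

lemma inj_string_code: "inj string_code"
proof (rule injI)
  fix \<sigma> \<tau> assume "string_code \<sigma> = string_code \<tau>"
  then have "map (of_bool :: bool \<Rightarrow> nat) \<sigma> = map of_bool \<tau>"
    unfolding string_code_def using inj_list_encode by (simp add: inj_eq)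
  moreover have "inj (of_bool :: bool \<Rightarrow> nat)" by (auto simp: inj_def)
  ultimately show "\<sigma> = \<tau>" by (metis inj_map_eq_map)
qed

lemma prefix_unary:
  assumes "prefix (replicate m True @ [False]) (replicate n True @ [False])"
  shows "m = n"
proof (rule ccontr)
  assume "m \<noteq> n"
  with prefix_length_le[OF assms] have "m < n" by simp
  obtain zs where zs: "replicate n True @ [False] = (replicate m True @ [False]) @ zs"
    using assms by (auto simp: prefix_def)
  have "\<not> (replicate n True @ [False]) ! m"
    unfolding zs by (simp add: nth_append)
  with \<open>m < n\<close> show False by (simp add: nth_append)
qed

lemma computable_unary_code:
  "computable f \<Longrightarrow> computable (\<lambda>x. string_code (replicate (f x) True @ [False]))"
proof -
  assume f: "computable f"
  have "string_code (replicate n True @ [False]) =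
      rec_nat (Suc (prod_encode (0, 0))) (\<lambda>_ r. Suc (prod_encode (1, r))) n" for n
    by (induction n) (simp_all add: string_code_def)
  then show ?thesis by (simp only:) (intro computable_intros f)
qed

lemma string_code_binary:
  assumes "\<forall>b\<in>set w. b \<le> 1"
  shows "string_code (map (\<lambda>b. b = 1) w) = list_encode w"
proof -
  have "map (of_bool \<circ> (\<lambda>b. b = 1)) w = map (\<lambda>b. b) w"
    using assms by (intro map_cong) (auto simp: le_Suc_eq)
  then show ?thesis by (simp add: string_code_def)
qed

definition compresses :: "(bool list \<rightharpoonup> bool list) \<Rightarrow> nat \<Rightarrow> nat \<Rightarrow> bool" where
  "compresses U c C \<longleftrightarrow> (\<forall>\<sigma> w.
    length w = output_length (length \<sigma>) (list_encode \<sigma>) \<longrightarrow> (\<forall>b\<in>set w. b \<le> 1) \<longrightarrow>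
    big staircase (length \<sigma>) (forces c w) \<sigma> \<longrightarrow>
    (\<exists>w. length w = output_length (length \<sigma>) (list_encode \<sigma>) \<and> (\<forall>b\<in>set w. b \<le> 1) \<and>
      big staircase (length \<sigma>) (forces c w) \<sigma> \<and>
      prefix_complexity U (map (\<lambda>b. b = 1) w) \<le> C + list_encode \<sigma>))"

text \<open>
  The machine reads the code \<open>z\<close> of a string \<open>\<sigma>\<close> in unary and outputs the first binary string
  of the required length found to be forced on a bushy tree above \<open>\<sigma>\<close>. The output is much longer
  than \<open>z\<close>, so the wasteful unary coding does no harm.
\<close>

lemma compression:
  assumes "universal_machine U"
  shows "\<exists>C. compresses U c C"
proof -
  define good where "good = (\<lambda>z w s d.
    length (list_decode w) = output_length (length (list_decode z)) z \<and>
    (\<forall>b\<in>set (list_decode w). b \<le> 1) \<and> tree_code c z w s d)"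
  define unary where "unary = (\<lambda>z. replicate z True @ [False])"
  define R where "R = (\<lambda>x t. x = string_code (unary (lft t)) \<and>
    good (lft t) (lft (rgt t)) (lft (rgt (rgt t))) (rgt (rgt (rgt t))))"
  define f where "f = (\<lambda>x. if \<exists>t. R x t then Some (lft (rgt (LEAST t. R x t))) else None)"
  define M where "M = (\<lambda>\<sigma>. map_option (\<lambda>y. map (\<lambda>b. b = 1) (list_decode y)) (f (string_code \<sigma>)))"
  have f_good: "\<exists>z s d. x = string_code (unary z) \<and> good z y s d" if "f x = Some y" for x y
  proof -
    from that have "\<exists>t. R x t" "y = lft (rgt (LEAST t. R x t))"
      by (auto simp: f_def split: if_splits)
    then show ?thesis
      using LeastI_ex[of "R x"] unfolding R_def by blast
  qed
  have "decidable (\<lambda>p. R (lft p) (rgt p))"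
    unfolding R_def good_def tree_code_def unary_def
    by (intro computable_intros computable_unary_code)
  moreover have "computable (\<lambda>t. lft (rgt t))" by (intro computable_intros)
  ultimately have "partial_recursive f"
    unfolding f_def by (rule partial_recursive_search)
  moreover have "f (string_code \<sigma>) = map_option string_code (M \<sigma>)" for \<sigma>
  proof (cases "f (string_code \<sigma>)")
    case (Some y)
    then have "\<forall>b\<in>set (list_decode y). b \<le> 1"
      using f_good by (auto simp: good_def)
    then show ?thesis using Some by (simp add: M_def string_code_binary del: One_nat_def)
  qed (simp add: M_def)
  ultimately have "partial_recursive_on_strings M"
    unfolding partial_recursive_on_strings_def by blast
  moreover have "\<sigma> = \<tau>" if "\<sigma> \<in> dom M" "\<tau> \<in> dom M" "prefix \<sigma> \<tau>" for \<sigma> \<tau>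
  proof -
    have "\<exists>z. \<rho> = unary z" if \<rho>: "\<rho> \<in> dom M" for \<rho>
    proof -
      obtain y where "f (string_code \<rho>) = Some y" using \<rho> by (auto simp: M_def)
      from f_good[OF this] show ?thesis by (auto dest: injD[OF inj_string_code])
    qed
    with that show ?thesis
      using prefix_unary unfolding unary_def by metis
  qed
  ultimately have "prefix_free_machine M"
    unfolding prefix_free_machine_def by blast
  with assms obtain \<rho> where \<rho>: "\<And>\<tau>. U (\<rho> @ \<tau>) = M \<tau>"
    unfolding universal_machine_def by blast
  show ?thesis
    unfolding compresses_def
  proof (intro exI[of _ "Suc (length \<rho>)"] allI impI)
    fix \<sigma> w
    assume "length w = output_length (length \<sigma>) (list_encode \<sigma>)" "\<forall>b\<in>set w. b \<le> 1"
      "big staircase (length \<sigma>) (forces c w) \<sigma>"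
    then obtain s d where "good (list_encode \<sigma>) (list_encode w) s d"
      unfolding good_def big_iff_tree_code by auto
    then have "R (string_code (unary (list_encode \<sigma>)))
        (prod_encode (list_encode \<sigma>, prod_encode (list_encode w, prod_encode (s, d))))"
      by (simp add: R_def)
    then have "\<exists>t. R (string_code (unary (list_encode \<sigma>))) t" by blast
    then obtain y where y: "f (string_code (unary (list_encode \<sigma>))) = Some y"
      by (auto simp: f_def)
    obtain z s d where "string_code (unary (list_encode \<sigma>)) = string_code (unary z)"
      and g: "good z y s d"
      using f_good[OF y] by blast
    then have "unary (list_encode \<sigma>) = unary z"
      using inj_string_code by (simp add: inj_eq)
    then have z: "z = list_encode \<sigma>"
      unfolding unary_def by (metis prefix_unary prefix_order.refl)
    have "U (\<rho> @ unary (list_encode \<sigma>)) = Some (map (\<lambda>b. b = 1) (list_decode y))"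
      unfolding \<rho> by (simp add: M_def y)
    then have "prefix_complexity U (map (\<lambda>b. b = 1) (list_decode y)) \<le>
        length (\<rho> @ unary (list_encode \<sigma>))"
      unfolding prefix_complexity_def by (intro Least_le) blast
    then have "prefix_complexity U (map (\<lambda>b. b = 1) (list_decode y)) \<le> Suc (length \<rho>) + list_encode \<sigma>"
      by (simp add: unary_def)
    moreover have "big staircase (length \<sigma>) (forces c (list_decode y)) \<sigma>"
      using g z unfolding good_def big_iff_tree_code by auto
    ultimately show "\<exists>w. length w = output_length (length \<sigma>) (list_encode \<sigma>) \<and> (\<forall>b\<in>set w. b \<le> 1) \<and>
      big staircase (length \<sigma>) (forces c w) \<sigma> \<and>
      prefix_complexity U (map (\<lambda>b. b = 1) w) \<le> Suc (length \<rho>) + list_encode \<sigma>"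
      using g z unfolding good_def by (intro exI[of _ "list_decode y"]) simp
  qed
qed

section \<open>Forcing with bushy trees\<close>

text \<open>
  \<open>decides U C c N B \<sigma>\<close>: either every function avoiding \<open>B\<close> makes the program \<open>c\<close> fail to compute
  a total binary sequence, or \<open>\<sigma>\<close> forces a highly compressible initial segment.
\<close>

definition decides ::
  "(bool list \<rightharpoonup> bool list) \<Rightarrow> nat \<Rightarrow> nat \<Rightarrow> nat \<Rightarrow> nat list set \<Rightarrow> nat list \<Rightarrow> bool" where
  "decides U C c N B \<sigma> \<longleftrightarrow>
    (\<exists>l. {\<tau>. \<forall>i<l. \<exists>b\<le>1. entry c i b \<in> derivable (oracle_of \<tau>)} \<subseteq> B) \<or>
    (\<exists>w n z. N \<le> n \<and> length w = output_length n z \<and> (\<forall>b\<in>set w. b \<le> 1) \<and>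
      prefix_complexity U (map (\<lambda>b. b = 1) w) \<le> C + z \<and> \<sigma> \<in> forces c w)"

lemma forcing_step:
  assumes compress: "compresses U c C"
    and \<sigma>: "bounded_by staircase \<sigma>" "\<not> big staircase k B \<sigma>" "k \<le> staircase (length \<sigma>)"
  shows "\<exists>\<rho> k' B'. \<rho> \<noteq> [] \<and> B \<subseteq> B' \<and> bounded_by staircase (\<rho> @ \<sigma>) \<and>
    \<not> big staircase k' B' (\<rho> @ \<sigma>) \<and> k' \<le> staircase (length (\<rho> @ \<sigma>)) \<and>
    decides U C c N B' (\<rho> @ \<sigma>)"
proof -
  obtain m where m: "m \<ge> max N (max k (length \<sigma>))" and jump: "staircase (Suc m) = jump (Suc m) (staircase m)"
    using staircase_jump by blast
  define n where "n = Suc m"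
  have n: "N \<le> n" "k \<le> n" "length \<sigma> < n" using m by (auto simp: n_def)
  obtain \<rho> where \<rho>: "length \<rho> = n - length \<sigma>" "\<not> big staircase k B (\<rho> @ \<sigma>)" "bounded_by staircase (\<rho> @ \<sigma>)"
    using not_big_extend[OF staircase_mono \<sigma>(3,2,1)] by blast
  define \<tau> where "\<tau> = \<rho> @ \<sigma>"
  have \<tau>: "length \<tau> = n" "\<rho> \<noteq> []" using \<rho>(1) n(3) by (auto simp: \<tau>_def)
  have not_big: "\<not> big staircase n B \<tau>"
    using \<rho>(2) big_mono[OF _ n(2)] by (auto simp: \<tau>_def)
  define L where "L = output_length n (list_encode \<tau>)"
  have "list_encode \<tau> \<le> max_code (staircase m) n"
    using list_encode_le_max_code[of \<tau> "staircase m"] bounded_by_set[OF staircase_mono \<rho>(3), of m] \<tau>(1)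
    by (simp add: \<tau>_def n_def)
  then have "L \<le> output_length n (max_code (staircase m) n)"
    unfolding L_def output_length_def by (intro mult_le_mono) auto
  then have "(2::nat) ^ L \<le> 2 ^ output_length n (max_code (staircase m) n)"
    by (intro power_increasing) auto
  then have "2 * n * 2 ^ L \<le> staircase n"
    using jump unfolding n_def[symmetric] jump_def by (simp add: trans_le_add1)
  moreover have "n * 1 \<le> n * 2 ^ L" by (intro mult_le_mono) auto
  ultimately have large: "n + n * 2 ^ L \<le> staircase n" by linarith
  define D where "D = {\<tau>. \<forall>i<L. \<exists>b\<le>1. entry c i b \<in> derivable (oracle_of \<tau>)}"
  show ?thesis
  proof (cases "big staircase (n * 2 ^ L) D \<tau>")
    case False
    then have "\<not> big staircase (n + n * 2 ^ L) (B \<union> D) \<tau>"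
      using not_big big_Un by blast
    moreover have "decides U C c N (B \<union> D) \<tau>"
      unfolding decides_def D_def by blast
    ultimately show ?thesis
      using \<rho>(3) \<tau> large unfolding \<tau>_def by blast
  next
    case True
    define W where "W = {w. set w \<subseteq> {0, 1::nat} \<and> length w = L}"
    have W: "finite W" "card W = 2 ^ L"
      unfolding W_def by (simp_all add: finite_lists_length_eq card_lists_length_eq numeral_2_eq_2)
    have "D \<subseteq> (\<Union>w\<in>W. forces c w)"
    proof
      fix \<tau> assume "\<tau> \<in> D"
      then obtain g where g: "\<And>i. i < L \<Longrightarrow> g i \<le> 1 \<and> entry c i (g i) \<in> derivable (oracle_of \<tau>)"
        unfolding D_def by (auto, metis)
      have "g i \<in> {0, 1}" if "i < L" for i using g[OF that] by auto
      then have "map g [0..<L] \<in> W" unfolding W_def by force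
      moreover have "\<tau> \<in> forces c (map g [0..<L])" using g by (simp add: forces_def)
      ultimately show "\<tau> \<in> (\<Union>w\<in>W. forces c w)" by blast
    qed
    then have "big staircase (n * card W) (\<Union>w\<in>W. forces c w) \<tau>"
      using big_mono[OF True] W by simp
    moreover have "W \<noteq> {}" using W by auto
    ultimately obtain w where "w \<in> W" "big staircase n (forces c w) \<tau>"
      using big_UN W(1) by blast
    moreover from this have "length w = L" "\<forall>b\<in>set w. b \<le> 1"
      by (auto simp: W_def)
    ultimately obtain w where w: "length w = L" "\<forall>b\<in>set w. b \<le> 1" "big staircase n (forces c w) \<tau>"
        "prefix_complexity U (map (\<lambda>b. b = 1) w) \<le> C + list_encode \<tau>"
      using compress[unfolded compresses_def, THEN spec[of _ \<tau>], THEN spec[of _ w]] \<tau>(1)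
      unfolding L_def by auto
    obtain \<rho>' where \<rho>': "\<rho>' @ \<tau> \<in> forces c w" "\<not> big staircase n B (\<rho>' @ \<tau>)" "bounded_by staircase (\<rho>' @ \<tau>)"
      using big_leaf_not_big[OF w(3) not_big] \<rho>(3) unfolding \<tau>_def by blast
    have "n \<le> staircase (length (\<rho>' @ \<tau>))"
      using large monoD[OF staircase_mono, of n "length (\<rho>' @ \<tau>)"] \<tau>(1) by simp
    moreover have "decides U C c N B (\<rho>' @ \<tau>)"
      unfolding decides_def using w n(1) \<rho>'(1) L_def by blast
    ultimately show ?thesis
      using \<rho>' \<tau>(2) unfolding \<tau>_def
      by (intro exI[of _ "\<rho>' @ \<rho>"] exI[of _ n] exI[of _ B]) simp
  qed
qed

lemma generic_function:
  assumes "\<And>c. compresses U c (C c)"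
  obtains Y :: "nat \<Rightarrow> nat" and \<sigma> :: "nat \<Rightarrow> nat list" and B :: "nat \<Rightarrow> nat list set"
  where "\<And>s. oracle_of (\<sigma> s) = (\<lambda>x. Some (Y x)) |` {..<length (\<sigma> s)}" "\<And>s. s \<le> length (\<sigma> s)"
    "\<And>s. bounded_by staircase (\<sigma> s)" "\<And>s t. s \<le> t \<Longrightarrow> \<sigma> t \<notin> B s"
    "B 0 = {\<tau>. \<exists>x v. oracle_of \<tau> x = Some v \<and> \<psi> x = Some v}"
    "\<And>c N. \<exists>s. decides U (C c) c N (B s) (\<sigma> s)"
proof -
  define P where "P = (\<lambda>s (\<sigma>, B, k). bounded_by staircase \<sigma> \<and> \<not> big staircase k B \<sigma> \<and>
    k \<le> staircase (length \<sigma>) \<and> s \<le> length \<sigma> \<and>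
    (s = 0 \<longrightarrow> B = {\<tau>. \<exists>x v. oracle_of \<tau> x = Some v \<and> \<psi> x = Some v}))"
  define Q where "Q = (\<lambda>s (\<sigma>, B :: nat list set, k :: nat) (\<sigma>', B', k' :: nat). (\<exists>\<rho>. \<sigma>' = \<rho> @ \<sigma>) \<and> B \<subseteq> B' \<and>
    decides U (C (lft s)) (lft s) (rgt s) B' \<sigma>')"
  have "\<exists>f. \<forall>s. P s (f s) \<and> Q s (f s) (f (Suc s))"
  proof (rule dependent_nat_choice)
    show "\<exists>x. P 0 x"
      using not_big_diagonal[of staircase \<psi>] staircase_0 unfolding P_def
      by (intro exI[of _ "([], {\<tau>. \<exists>x v. oracle_of \<tau> x = Some v \<and> \<psi> x = Some v}, 2)"]) simp
  next
    fix x s assume "P s x"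
    obtain \<sigma> B k where x: "x = (\<sigma>, B, k)" by (cases x)
    have \<sigma>: "bounded_by staircase \<sigma>" "\<not> big staircase k B \<sigma>" "k \<le> staircase (length \<sigma>)" "s \<le> length \<sigma>"
      using \<open>P s x\<close> by (auto simp: P_def x)
    from forcing_step[OF assms \<sigma>(1-3), of "lft s" "rgt s"]
    obtain \<rho> k' B' where "\<rho> \<noteq> []" "B \<subseteq> B'" "bounded_by staircase (\<rho> @ \<sigma>)"
      "\<not> big staircase k' B' (\<rho> @ \<sigma>)" "k' \<le> staircase (length (\<rho> @ \<sigma>))"
      "decides U (C (lft s)) (lft s) (rgt s) B' (\<rho> @ \<sigma>)"
      by blast
    moreover from this have "Suc s \<le> length (\<rho> @ \<sigma>)"
      using \<sigma>(4) by (cases \<rho>) auto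
    ultimately have "P (Suc s) (\<rho> @ \<sigma>, B', k') \<and> Q s x (\<rho> @ \<sigma>, B', k')"
      unfolding P_def Q_def x by auto
    then show "\<exists>y. P (Suc s) y \<and> Q s x y" by blast
  qed
  then obtain f where f: "\<And>s. P s (f s)" "\<And>s. Q s (f s) (f (Suc s))" by blast
  define \<sigma> where "\<sigma> s = fst (f s)" for s
  define B where "B s = fst (snd (f s))" for s
  define Y where "Y x = the (oracle_of (\<sigma> (Suc x)) x)" for x
  have P: "bounded_by staircase (\<sigma> s)" "\<sigma> s \<notin> B s" "s \<le> length (\<sigma> s)"
    "s = 0 \<Longrightarrow> B s = {\<tau>. \<exists>x v. oracle_of \<tau> x = Some v \<and> \<psi> x = Some v}" for s
    using f(1)[of s] big.leaf unfolding P_def \<sigma>_def B_def by (auto simp: case_prod_beta)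
  have Q: "\<exists>\<rho>. \<sigma> (Suc s) = \<rho> @ \<sigma> s" "B s \<subseteq> B (Suc s)"
    "decides U (C (lft s)) (lft s) (rgt s) (B (Suc s)) (\<sigma> (Suc s))" for s
    using f(2)[of s] unfolding Q_def \<sigma>_def B_def by (auto simp: case_prod_beta)
  have B_mono: "B s \<subseteq> B t" if "s \<le> t" for s t
    using lift_Suc_mono_le[of B, OF Q(2) that] .
  have ext: "oracle_of (\<sigma> s) \<subseteq>\<^sub>m oracle_of (\<sigma> t)" if "s \<le> t" for s t
    using that
  proof (induction rule: dec_induct)
    case (step t)
    then show ?case using Q(1)[of t] oracle_append map_le_trans by metis
  qed simp
  have dom: "dom (oracle_of (\<sigma> s)) = {..<length (\<sigma> s)}" for s
    by (auto simp: oracle_of_def dom_def)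
  have "oracle_of (\<sigma> s) x = Some (Y x)" if "x < length (\<sigma> s)" for s x
  proof -
    have "x \<in> dom (oracle_of (\<sigma> s))" "x \<in> dom (oracle_of (\<sigma> (Suc x)))"
      using that P(3)[of "Suc x"] unfolding dom by auto
    moreover have "oracle_of (\<sigma> s) \<subseteq>\<^sub>m oracle_of (\<sigma> (Suc x)) \<or> oracle_of (\<sigma> (Suc x)) \<subseteq>\<^sub>m oracle_of (\<sigma> s)"
      using ext by (meson nle_le)
    ultimately have "oracle_of (\<sigma> s) x = oracle_of (\<sigma> (Suc x)) x"
      unfolding map_le_def by metis
    then show ?thesis
      using \<open>x \<in> dom (oracle_of (\<sigma> s))\<close> by (metis Y_def domD option.sel)
  qed
  then have Y: "oracle_of (\<sigma> s) = (\<lambda>x. Some (Y x)) |` {..<length (\<sigma> s)}" for s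
    by (auto simp: restrict_map_def oracle_of_def fun_eq_iff)
  have avoid: "\<sigma> t \<notin> B s" if "s \<le> t" for s t
    using P(2) B_mono[OF that] by blast
  have "\<exists>s. decides U (C c) c N (B s) (\<sigma> s)" for c N
    using Q(3)[of "prod_encode (c, N)"] by auto
  from Y P(3,1) avoid P(4)[OF refl] this show ?thesis by (rule that)
qed

theorem mainTheorem9:
  fixes U :: "bool list \<rightharpoonup> bool list"
  assumes "universal_machine U"
  shows "\<not> SC U \<le>\<^sub>w LUA_slow"
proof
  assume red: "SC U \<le>\<^sub>w LUA_slow"
  obtain \<psi> where \<psi>: "linearly_universal \<psi>"
    using linearly_universal_exists by blast
  obtain C where C: "\<And>c. compresses U c (C c)"
    using compression[OF assms] by metis
  obtain Y \<sigma> B where Y: "\<And>s. oracle_of (\<sigma> s) = (\<lambda>x. Some (Y x)) |` {..<length (\<sigma> s)}"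
    and len: "\<And>s. s \<le> length (\<sigma> s)" and bdd: "\<And>s. bounded_by staircase (\<sigma> s)"
    and avoid: "\<And>s t. s \<le> t \<Longrightarrow> \<sigma> t \<notin> B s"
    and B0: "B 0 = {\<tau>. \<exists>x v. oracle_of \<tau> x = Some v \<and> \<psi> x = Some v}"
    and dec: "\<And>c N. \<exists>s. decides U (C c) c N (B s) (\<sigma> s)"
    by (rule generic_function[of U C \<psi>, OF C]) (rule that)
  have Y_at: "oracle_of (\<sigma> (Suc x)) x = Some (Y x)" for x
    using len[of "Suc x"] by (simp add: Y)
  have "Y x < staircase x" for x
    using bounded_by_oracle[OF bdd Y_at] .
  moreover have "\<psi> x \<noteq> Some (Y x)" for x
    using avoid[of 0 "Suc x"] Y_at[of x] B0 by auto
  ultimately have "Y \<in> LUA (\<lambda>n. real (staircase n))"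
    unfolding LUA_def using \<psi> by auto
  then have "Y \<in> LUA_slow"
    unfolding LUA_slow_def using slow_growing_staircase by blast
  with red obtain X where X: "shift_complex U X" "turing_computes Y (\<lambda>n. of_bool (X n))"
    unfolding weakly_reducible_def SC_def by blast
  let ?h = "\<lambda>x. Some (Y x)"
  obtain c where c: "\<And>x v. of_bool (X x) = v \<longleftrightarrow> entry c x v \<in> derivable ?h"
    using recursive_in_code[OF X(2)[unfolded turing_computes_def], of ?h] by auto
  obtain \<delta> :: real and a :: nat where \<delta>: "0 < \<delta>"
    and K: "\<And>\<tau>. \<tau> \<in> substrings X \<Longrightarrow> real (prefix_complexity U \<tau>) \<ge> \<delta> * real (length \<tau>) - real a"
    using X(1) unfolding shift_complex_def by blast
  define N where "N = nat \<lceil>(real (C c) + real a + 1) / \<delta>\<rceil>"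
  obtain s where "decides U (C c) c N (B s) (\<sigma> s)" using dec by blast
  then consider l where "{\<tau>. \<forall>i<l. \<exists>b\<le>1. entry c i b \<in> derivable (oracle_of \<tau>)} \<subseteq> B s"
    | w n z where "N \<le> n" "length w = output_length n z" "\<forall>b\<in>set w. b \<le> 1"
      "prefix_complexity U (map (\<lambda>b. b = 1) w) \<le> C c + z" "\<sigma> s \<in> forces c w"
    unfolding decides_def by blast
  then show False
  proof cases
    case (1 l)
    have "(\<lambda>i. entry c i (of_bool (X i))) ` {..<l} \<subseteq> derivable ?h"
      using c by blast
    then obtain d where d: "derivation ?h d" "(\<lambda>i. entry c i (of_bool (X i))) ` {..<l} \<subseteq> set d"
      by (rule finite_subset_derivable[rotated]) simp_all
    obtain m where m: "\<And>n. m \<le> n \<Longrightarrow> derivation (?h |` {..<n}) d"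
      using derivation_finite_use[OF d(1)] by blast
    let ?t = "max m s"
    have "derivation (oracle_of (\<sigma> ?t)) d"
      unfolding Y using len[of ?t] by (intro m) simp
    then have "\<forall>i<l. entry c i (of_bool (X i)) \<in> derivable (oracle_of (\<sigma> ?t))"
      using d(2) unfolding derivable_def by blast
    moreover have "of_bool (X i) \<le> (1::nat)" for i by simp
    ultimately have "\<sigma> ?t \<in> B s" using 1 by blast
    then show False using avoid[of s ?t] by simp
  next
    case (2 w n z)
    have "oracle_of (\<sigma> s) \<subseteq>\<^sub>m ?h"
      unfolding Y by (simp add: map_le_def)
    then have sub: "derivable (oracle_of (\<sigma> s)) \<subseteq> derivable ?h"
      by (rule derivable_mono)
    have "w ! i = of_bool (X i)" if "i < length w" for i
    proof -
      have "entry c i (w ! i) \<in> derivable ?h"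
        using that 2(5) sub by (auto simp: forces_def)
      then show ?thesis using c[of i "w ! i"] by simp
    qed
    then have "map (\<lambda>b. b = 1) w = map X [0..<length w]"
      by (intro nth_equalityI) auto
    then have "map (\<lambda>b. b = 1) w \<in> substrings X"
      unfolding substrings_def by blast
    from K[OF this] have upper: "\<delta> * real (length w) \<le> real (C c) + real z + real a"
      using 2(4) by simp
    define E where "E = real (C c) + real a + 1"
    have "E / \<delta> \<le> real (Suc n)"
      using 2(1) unfolding N_def E_def by linarith
    then have "E \<le> \<delta> * real (Suc n)"
      using \<delta> by (simp add: field_simps)
    then have "E * real (z + 2) \<le> \<delta> * real (Suc n) * real (z + 2)"
      by (intro mult_right_mono) auto
    also have "\<dots> = \<delta> * real (length w)"
      unfolding 2(2) output_length_def by (simp only: of_nat_mult mult.assoc)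
    also have "\<dots> < E + real z"
      using upper by (simp add: E_def)
    also have "\<dots> \<le> E * 1 + E * real z"
      using mult_right_mono[of 1 E "real z"] by (simp add: E_def)
    also have "\<dots> \<le> E * real (z + 2)"
      by (simp add: E_def algebra_simps)
    finally show False by simp
  qed
qed

end
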